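(* Let $C>0$ and $M<1/2$ be known real constants. There exists a Bernoulli factory for the function $f(p)=Cp$ (a single algorithm, depending on $C$ and $M$ but not on $p$), valid for all $p\in[0,1]$ with $Cp\le M$, whose running time $T$ satisfies, for every $p\in[0,1]$ with $Cp\le M$, $$\mathbb{E}[T]\ \le\ \frac{C}{(1-2M)(1+Cp)}+Cp\cdot\left[C\,\frac{15.2}{1-2M+Cp}\right].$$
   Context: $\mathsf{Bern}(q)$ denotes the distribution on $\{0,1\}$ giving mass $q$ to $1$. A draw from $\mathsf{Bern}(q)$ is called a $q$-coin flip. Bernoulli factory: let $D\subseteq[0,1]$ be the set of allowed values of $p$ and $f:D\to[0,1]$. Let $\mathcal{A}$ be a computable function that takes as input a number $u\in[0,1]$ together with a sequence of values in $\{0,1\}$ and returns an output in $\{0,1\}$. For $p\in D$, let $X_1,X_2,\ldots$ be iid $\mathsf{Bern}(p)$ and $U$ uniform on $[0,1]$, independent of the $X_i$. Let $T$ be the infimum of times $t\in\{0,1,2,\ldots\}$ such that the value of $\mathcal{A}(U,X_1,X_2,\ldots)$ only depends on the values of $X_1,\ldots,X_t$ (and on $U$). $\mathcal{A}$ is a Bernoulli factory for $f$ on $D$ if for every $p\in D$: (1) $T$ is a stopping time with respect to the natural filtration (generated by $U$ and $X_1,\ldots,X_t$, $t\ge 0$) that is finite with probability 1; (2) $\mathcal{A}(U,X_1,X_2,\ldots)\sim\mathsf{Bern}(f(p))$. $T$ (the number of flips of the $p$-coin used) is called the running time. *)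

theory Defs
  imports "HOL-Probability.Probability"
begin

section \<open>Algorithms\<close>

text \<open>
  Inputs of an algorithm are a real number and a 0/1 sequence, and the known constants are arbitrary
  (possibly uncomputable) reals, so computability is understood in the real-number model of
  computation (real RAM, Blum--Shub--Smale machine): programs work on registers holding reals, with
  exact rational operations and exact comparisons.  The only constants available to a program are
  rational numbers and the known constants, which are part of its input.
\<close>

datatype rexp =
    Reg nat
  | Const rat
  | Add rexp rexp
  | Sub rexp rexp
  | Mul rexp rexp
  | Div rexp rexp

primrec rval :: "rexp \<Rightarrow> (nat \<Rightarrow> real) \<Rightarrow> real" where
  "rval (Reg k) r = r k"
| "rval (Const q) r = of_rat q"
| "rval (Add a b) r = rval a r + rval b r"
| "rval (Sub a b) r = rval a r - rval b r"
| "rval (Mul a b) r = rval a r * rval b r"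
| "rval (Div a b) r = rval a r / rval b r"

text \<open>
  \<open>Flip k\<close> stores the next unread element of the 0/1 sequence in register \<open>k\<close>; \<open>IfLess a b c d\<close> and
  \<open>WhileLess a b c\<close> branch and loop on \<open>a < b\<close>.
\<close>

datatype prog =
    Skip
  | Assign nat rexp
  | Flip nat
  | Seq prog prog
  | IfLess rexp rexp prog prog
  | WhileLess rexp rexp prog

text \<open>
  \<open>exec x P (r, n) (r', n')\<close>: started with register contents \<open>r\<close> after \<open>n\<close> elements of the sequence
  \<open>x\<close> have been read, \<open>P\<close> halts with register contents \<open>r'\<close> after \<open>n'\<close> elements have been read.
\<close>

inductive exec ::
  "(nat \<Rightarrow> bool) \<Rightarrow> prog \<Rightarrow> (nat \<Rightarrow> real) \<times> nat \<Rightarrow> (nat \<Rightarrow> real) \<times> nat \<Rightarrow> bool"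
  for x :: "nat \<Rightarrow> bool" where
  Skip: "exec x Skip s s"
| Assign: "exec x (Assign k a) (r, n) (r(k := rval a r), n)"
| Flip: "exec x (Flip k) (r, n) (r(k := of_bool (x n)), Suc n)"
| Seq: "exec x P s s' \<Longrightarrow> exec x Q s' s'' \<Longrightarrow> exec x (Seq P Q) s s''"
| IfTrue: "rval a (fst s) < rval b (fst s) \<Longrightarrow> exec x P s s' \<Longrightarrow> exec x (IfLess a b P Q) s s'"
| IfFalse: "\<not> rval a (fst s) < rval b (fst s) \<Longrightarrow> exec x Q s s' \<Longrightarrow> exec x (IfLess a b P Q) s s'"
| WhileFalse: "\<not> rval a (fst s) < rval b (fst s) \<Longrightarrow> exec x (WhileLess a b P) s s"
| WhileTrue: "rval a (fst s) < rval b (fst s) \<Longrightarrow> exec x P s s' \<Longrightarrow>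
    exec x (WhileLess a b P) s' s'' \<Longrightarrow> exec x (WhileLess a b P) s s''"

text \<open>Register 0 initially holds \<open>u\<close>, the following ones the known constants; all others hold 0.\<close>

definition init_regs :: "real list \<Rightarrow> real \<Rightarrow> nat \<Rightarrow> real" where
  "init_regs cs u k = (if k < length (u # cs) then (u # cs) ! k else 0)"

text \<open>The program \<open>P\<close>, on input \<open>(u, x)\<close>, halts with the value \<open>y\<close> in register 0.\<close>

definition outputs :: "real list \<Rightarrow> prog \<Rightarrow> real \<Rightarrow> (nat \<Rightarrow> bool) \<Rightarrow> real \<Rightarrow> bool" where
  "outputs cs P u x y \<longleftrightarrow> (\<exists>r n. exec x P (init_regs cs u, 0) (r, n) \<and> r 0 = y)"


section \<open>Bernoulli factories\<close>

text \<open>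
  The values 0 and 1 of coin flips and of the output are represented as \<open>False\<close> and \<open>True\<close>.
  A point \<open>(u, x)\<close> of the sample space gives \<open>U = u\<close> and \<open>X\<^sub>1 = x 0\<close>, \<open>X\<^sub>2 = x 1\<close>, and so on.
\<close>

definition factory_space :: "real \<Rightarrow> (real \<times> (nat \<Rightarrow> bool)) measure" where
  "factory_space p =
     uniform_measure lborel {0..1} \<Otimes>\<^sub>M (\<Pi>\<^sub>M i\<in>UNIV. measure_pmf (bernoulli_pmf p))"

definition natural_filtration :: "enat \<Rightarrow> (real \<times> (nat \<Rightarrow> bool)) measure" where
  "natural_filtration t =
     sigma UNIV ({{\<omega>. fst \<omega> \<in> B} | B. B \<in> sets borel} \<union> {{\<omega>. snd \<omega> i} | i. enat i < t})"

text \<open>The infimum is \<open>\<infinity>\<close> if there is no such \<open>t\<close>.\<close>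

definition running_time :: "(real \<Rightarrow> (nat \<Rightarrow> bool) \<Rightarrow> bool) \<Rightarrow> real \<times> (nat \<Rightarrow> bool) \<Rightarrow> enat" where
  "running_time A = (\<lambda>(u, x). INF t \<in> {t. \<forall>y. (\<forall>i<t. y i = x i) \<longrightarrow> A u y = A u x}. enat t)"

text \<open>
  Since a Bernoulli factory need only stop with probability 1, so does a program computing it;
  but whenever the program halts, its output is the value of \<open>A\<close>.
\<close>

definition computable_on :: "real list \<Rightarrow> real set \<Rightarrow> (real \<Rightarrow> (nat \<Rightarrow> bool) \<Rightarrow> bool) \<Rightarrow> bool" where
  "computable_on cs D A \<longleftrightarrow>
     (\<exists>P. (\<forall>u\<in>{0..1}. \<forall>x y. outputs cs P u x y \<longrightarrow> y = of_bool (A u x)) \<and>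
          (\<forall>p\<in>D. AE (u, x) in factory_space p. \<exists>y. outputs cs P u x y))"

text \<open>
  \<open>bernoulli_factory cs f D A\<close>: \<open>A\<close> is a Bernoulli factory for \<open>f\<close> on \<open>D\<close>, computable from the known
  constants \<open>cs\<close>.
\<close>

definition bernoulli_factory ::
  "real list \<Rightarrow> (real \<Rightarrow> real) \<Rightarrow> real set \<Rightarrow> (real \<Rightarrow> (nat \<Rightarrow> bool) \<Rightarrow> bool) \<Rightarrow> bool" where
  "bernoulli_factory cs f D A \<longleftrightarrow>
     D \<subseteq> {0..1} \<and> f ` D \<subseteq> {0..1} \<and> computable_on cs D A \<and>
     (\<forall>p\<in>D.
        stopping_time natural_filtration (running_time A) \<and>
        (AE \<omega> in factory_space p. running_time A \<omega> < \<infinity>) \<and>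
        (\<lambda>(u, x). A u x) \<in> factory_space p \<rightarrow>\<^sub>M count_space UNIV \<and>
        distr (factory_space p) (count_space UNIV) (\<lambda>(u, x). A u x) =
          measure_pmf (bernoulli_pmf (f p)))"

end

theory Submission imports Defs begin

text \<open>
  Write \<open>r = C * p\<close> and \<open>\<delta> = 1 - 2 * M\<close>.  If \<open>M \<le> 0\<close>, then \<open>p = 0\<close> is the only admissible value, if there
  is one at all, and the constant output 0 does.  So let \<open>M > 0\<close>.

  The algorithm is a Markov chain of phases.  Each phase \<open>s\<close> owes a coin: from \<open>s\<close> on, output 1 has to
  come up with some probability \<open>target s\<close>, a function of the unknown \<open>p\<close>.  A step keeps the debt in
  balance, which says that \<open>target\<close> is harmonic for the chain, and the chain ends in phases that
  owe 0 or 1.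

  \<^item> \<open>Start\<close> owes \<open>r\<close>.  It flips the \<open>p\<close>-coin again and again, but before each flip gives up and outputs 0
    with probability \<open>\<delta> / (C + \<delta>)\<close>.  A head arrives with probability \<open>r / (\<delta> + r)\<close>, after \<open>C / (\<delta> + r)\<close>
    flips on average, flips before giving up included; this is at most the first term of the bound.  A head leads to \<open>Head\<close>, which therefore owes \<open>\<delta> + r\<close>.
  \<^item> \<open>Head\<close> outputs 1 with probability \<open>\<delta>\<close> and otherwise owes \<open>r / (2 * M)\<close>, at most one half.
  \<^item> \<open>Walk n i\<close> owes \<open>\<rho> n ^ i\<close>, where \<open>\<rho> n = n * r / ((n + 1) * M) \<le> n / (n + 1)\<close>.  Such a power is harmonic
    for the walk that moves \<open>i\<close> down at rate \<open>\<rho> n\<close> and up at rate 1, and the first rate is that of the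
    heads among coin flips made at rate \<open>n * C / ((n + 1) * M)\<close>, which is known.  At \<open>i = 0\<close> the output
    is 1.
  \<^item> The walk drifts upwards and would never output 0 by itself.  At a level \<open>b\<close>, the barrier of stage \<open>n\<close>,
    it is stopped with output 0, except with probability \<open>q ^ b\<close>, where \<open>q = \<rho> n / \<rho> (n + 1)\<close> does not
    depend on \<open>p\<close>; \<open>Kill n j\<close> carries out \<open>j\<close> trials of success probability \<open>q\<close>.  Survivors owe
    \<open>\<rho> (n + 1) ^ b\<close> and enter stage \<open>n + 1\<close>.

  In stage \<open>n\<close> the walk flips at a rate below \<open>C / M\<close> and its drift is at least \<open>1 / (n + 1)\<close>, so a level costs
  \<open>O(n * C / M)\<close> flips.  With barriers \<open>2 * (n + 1)\<^sup>2\<close> the stage then costs \<open>O(n\<^sup>2 * C / M)\<close> flips but is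
  survived with probability at most 1/6, and the costs of the stages add up to at most
  \<open>15.2 * C / (2 * M)\<close> from \<open>Walk 1 1\<close> on.  A head at \<open>Start\<close> leads there with probability \<open>2 * M\<close>, which
  yields the second term of the bound.  The estimate is a supersolution \<open>cost\<close> of the equations for the
  expected number of flips (lemma \<open>potential_cost\<close>); it also pays a small amount \<open>\<eta>\<close> for the steps
  without a flip, and thereby shows that the chain halts almost surely.

  All random choices other than coin flips come from the one uniform variable \<open>U\<close>: after the decision
  \<open>U < f\<close>, one of \<open>U / f\<close> and \<open>(U - f) / (1 - f)\<close> is again uniform and independent of the decision.
  The chain can thus be run by a loop without inner loops on a real random access machine.
\<close>

section \<open>The sample space and its one-step recursion\<close>

abbreviation uniform01 :: "real measure" where
  "uniform01 \<equiv> uniform_measure lborel {0..1}"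

abbreviation coins :: "real \<Rightarrow> (nat \<Rightarrow> bool) measure" where
  "coins p \<equiv> \<Pi>\<^sub>M i\<in>UNIV. measure_pmf (bernoulli_pmf p)"

lemma sets_coins [measurable_cong]: "sets (coins p) = sets (\<Pi>\<^sub>M i\<in>UNIV. count_space UNIV)"
  by (intro sets_PiM_cong) auto

lemma sets_factory_space [measurable_cong]:
  "sets (factory_space p) = sets (borel \<Otimes>\<^sub>M (\<Pi>\<^sub>M i\<in>UNIV. count_space UNIV))"
  unfolding factory_space_def by (intro sets_pair_measure_cong sets_coins) simp

lemma space_factory_space [simp]: "space (factory_space p) = UNIV"
  unfolding factory_space_def by (simp add: space_pair_measure space_PiM)

lemma prob_space_uniform01: "prob_space uniform01"
  by (rule prob_space_uniform_measure) auto

lemma prob_space_coins: "prob_space (coins p)"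
  by (intro prob_space_PiM measure_pmf.prob_space_axioms)

lemma prob_space_factory_space: "prob_space (factory_space p)"
proof -
  interpret U: prob_space uniform01 by (rule prob_space_uniform01)
  interpret X: prob_space "coins p" by (rule prob_space_coins)
  interpret P: pair_prob_space uniform01 "coins p" ..
  show ?thesis unfolding factory_space_def by (rule P.prob_space_axioms)
qed

lemma nn_integral_uniform01:
  assumes [measurable]: "h \<in> borel_measurable borel"
  shows "(\<integral>\<^sup>+u. h u \<partial>uniform01) = (\<integral>\<^sup>+u. h u * indicator {0..1} u \<partial>lborel)"
  by (subst nn_integral_uniform_measure) (auto simp: divide_ennreal_def)

text \<open>
  A uniform variable can be reused: conditioned on falling below \<open>f\<close>, or not, it is rescaled affinely to
  a uniform variable on the unit interval.
\<close>

lemma nn_integral_uniform01_split: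
  fixes f :: real and a b :: "real \<Rightarrow> ennreal"
  assumes f: "0 < f" "f < 1"
    and [measurable]: "a \<in> borel_measurable borel" "b \<in> borel_measurable borel"
  shows "(\<integral>\<^sup>+u. (if u < f then a (u / f) else b ((u - f) / (1 - f))) \<partial>uniform01) =
    ennreal f * (\<integral>\<^sup>+u. a u \<partial>uniform01) + ennreal (1 - f) * (\<integral>\<^sup>+u. b u \<partial>uniform01)"
proof -
  have "(\<integral>\<^sup>+u. (if u < f then a (u / f) else b ((u - f) / (1 - f))) \<partial>uniform01) =
      (\<integral>\<^sup>+u. a (u / f) * indicator {0..<f} u + b ((u - f) / (1 - f)) * indicator {f..1} u \<partial>lborel)"
    using f by (subst nn_integral_uniform01)
      (auto intro!: nn_integral_cong split: split_indicator)
  also have "\<dots> = (\<integral>\<^sup>+u. a (u / f) * indicator {0..<f} u \<partial>lborel) +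
      (\<integral>\<^sup>+u. b ((u - f) / (1 - f)) * indicator {f..1} u \<partial>lborel)"
    by (rule nn_integral_add) auto
  also have "(\<integral>\<^sup>+u. a (u / f) * indicator {0..<f} u \<partial>lborel) = ennreal f * (\<integral>\<^sup>+u. a u \<partial>uniform01)"
  proof -
    have "(\<integral>\<^sup>+u. a (u / f) * indicator {0..<f} u \<partial>lborel) =
        ennreal f * (\<integral>\<^sup>+u. a ((0 + f * u) / f) * indicator {0..<f} (0 + f * u) \<partial>lborel)"
      using f by (subst nn_integral_real_affine[where c = f and t = 0]) auto
    also have "(\<integral>\<^sup>+u. a ((0 + f * u) / f) * indicator {0..<f} (0 + f * u) \<partial>lborel) =
        (\<integral>\<^sup>+u. a u * indicator {0..1} u \<partial>lborel)"
      using f AE_lborel_singleton[of "1::real"]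
      by (intro nn_integral_cong_AE)
        (auto elim!: eventually_mono simp: zero_le_mult_iff split: split_indicator)
    finally show ?thesis by (simp add: nn_integral_uniform01)
  qed
  also have "(\<integral>\<^sup>+u. b ((u - f) / (1 - f)) * indicator {f..1} u \<partial>lborel) =
      ennreal (1 - f) * (\<integral>\<^sup>+u. b u \<partial>uniform01)"
  proof -
    have "(\<integral>\<^sup>+u. b ((u - f) / (1 - f)) * indicator {f..1} u \<partial>lborel) = ennreal (1 - f) *
        (\<integral>\<^sup>+u. b ((f + (1 - f) * u - f) / (1 - f)) * indicator {f..1} (f + (1 - f) * u) \<partial>lborel)"
      using f by (subst nn_integral_real_affine[where c = "1 - f" and t = f]) auto
    also have "(\<integral>\<^sup>+u. b ((f + (1 - f) * u - f) / (1 - f)) * indicator {f..1} (f + (1 - f) * u) \<partial>lborel) =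
        (\<integral>\<^sup>+u. b u * indicator {0..1} u \<partial>lborel)"
    proof (rule nn_integral_cong)
      fix u :: real
      have "f + (1 - f) * u \<le> 1 \<longleftrightarrow> (1 - f) * u \<le> (1 - f) * 1" by (simp add: algebra_simps)
      then have "f + (1 - f) * u \<in> {f..1} \<longleftrightarrow> u \<in> {0..1}"
        using f by (simp add: zero_le_mult_iff)
      then show "b ((f + (1 - f) * u - f) / (1 - f)) * indicator {f..1} (f + (1 - f) * u) =
          b u * indicator {0..1} u"
        using f unfolding indicator_def by simp
    qed
    finally show ?thesis by (simp add: nn_integral_uniform01)
  qed
  finally show ?thesis .
qed

definition rest :: "(nat \<Rightarrow> bool) \<Rightarrow> nat \<Rightarrow> bool" where
  "rest x = (\<lambda>i. x (Suc i))"

lemma measurable_rest [measurable]: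
  "rest \<in> (\<Pi>\<^sub>M i\<in>UNIV. count_space UNIV) \<rightarrow>\<^sub>M (\<Pi>\<^sub>M i\<in>UNIV. count_space UNIV)"
  by (rule measurable_PiM_single') (auto simp: rest_def)

lemma nn_integral_coins_Suc:
  assumes p: "0 \<le> p" "p \<le> 1"
    and meas: "\<And>b. G b \<in> borel_measurable (\<Pi>\<^sub>M i\<in>UNIV. count_space UNIV)"
  shows "(\<integral>\<^sup>+x. G (x 0) (rest x) \<partial>coins p) =
    ennreal p * (\<integral>\<^sup>+x. G True x \<partial>coins p) + ennreal (1 - p) * (\<integral>\<^sup>+x. G False x \<partial>coins p)"
proof -
  interpret sequence_space "measure_pmf (bernoulli_pmf p)" ..
  let ?B = "measure_pmf (bernoulli_pmf p)"
  note [measurable] = meas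
  have G [measurable]: "(\<lambda>x. G (x 0) (rest x)) \<in> borel_measurable (\<Pi>\<^sub>M i\<in>UNIV. count_space UNIV)"
  proof -
    have "(\<lambda>x. G (x 0) (rest x)) = (\<lambda>x. if x 0 then G True (rest x) else G False (rest x))"
      by auto
    also have "\<dots> \<in> borel_measurable (\<Pi>\<^sub>M i\<in>UNIV. count_space UNIV)" by measurable
    finally show ?thesis .
  qed
  have G': "(\<lambda>x. G (x 0) (rest x)) \<in> borel_measurable (coins p)"
    using G measurable_cong_sets[OF sets_coins refl] by blast
  have cn: "(\<lambda>(s, \<omega>). case_nat s \<omega>) \<in> ?B \<Otimes>\<^sub>M coins p \<rightarrow>\<^sub>M coins p"
    by measurable
  have "(\<integral>\<^sup>+x. G (x 0) (rest x) \<partial>coins p) =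
      (\<integral>\<^sup>+x. G (x 0) (rest x) \<partial>distr (?B \<Otimes>\<^sub>M coins p) (coins p) (\<lambda>(s, \<omega>). case_nat s \<omega>))"
    by (simp only: PiM_iter)
  also have "\<dots> = (\<integral>\<^sup>+z. (\<lambda>(s, \<omega>). G s \<omega>) z \<partial>(?B \<Otimes>\<^sub>M coins p))"
    using G' by (subst nn_integral_distr[OF cn]) (auto intro!: nn_integral_cong simp: rest_def)
  also have "\<dots> = (\<integral>\<^sup>+s. (\<integral>\<^sup>+\<omega>. G s \<omega> \<partial>coins p) \<partial>?B)"
  proof -
    have "(\<lambda>z. (\<lambda>(s, \<omega>). G s \<omega>) z) \<in> borel_measurable (?B \<Otimes>\<^sub>M coins p)"
    proof -
      have "(\<lambda>z. (\<lambda>(s, \<omega>). G s \<omega>) z) = (\<lambda>z. if fst z then G True (snd z) else G False (snd z))"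
        by (auto simp: fun_eq_iff split: if_splits)
      also have "\<dots> \<in> borel_measurable (?B \<Otimes>\<^sub>M coins p)" by measurable
      finally show ?thesis .
    qed
    from P.nn_integral_fst[OF this] show ?thesis by simp
  qed
  also have "\<dots> = ennreal p * (\<integral>\<^sup>+x. G True x \<partial>coins p) + ennreal (1 - p) * (\<integral>\<^sup>+x. G False x \<partial>coins p)"
    using p by (simp add: ac_simps ennreal_minus)
  finally show ?thesis .
qed

lemma nn_integral_factory_space:
  assumes "F \<in> borel_measurable (borel \<Otimes>\<^sub>M (\<Pi>\<^sub>M i\<in>UNIV. count_space UNIV))"
  shows "(\<integral>\<^sup>+\<omega>. F \<omega> \<partial>factory_space p) = (\<integral>\<^sup>+u. (\<integral>\<^sup>+x. F (u, x) \<partial>coins p) \<partial>uniform01)"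
proof -
  interpret X: prob_space "coins p" by (rule prob_space_coins)
  have "F \<in> borel_measurable (uniform01 \<Otimes>\<^sub>M coins p)"
    using assms measurable_cong_sets[OF sets_factory_space refl, unfolded factory_space_def] by blast
  from X.nn_integral_fst[OF this] show ?thesis by (simp add: factory_space_def)
qed

text \<open>
  Conditioning on the first step of an algorithm: a decision of probability \<open>f\<close> by the uniform variable
  and, if \<open>reading\<close>, a coin flip after the first outcome.  What remains of the sample space has the
  original distribution, and this turns statements about runs into recursions over the number of steps.
\<close>

lemma nn_integral_factory_space_step:
  fixes f :: real
  assumes p: "0 \<le> p" "p \<le> 1" and f: "0 < f" "f < 1"
    and meas [measurable]:
      "\<And>b. G b \<in> borel_measurable (borel \<Otimes>\<^sub>M (\<Pi>\<^sub>M i\<in>UNIV. count_space UNIV))"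
      "H \<in> borel_measurable (borel \<Otimes>\<^sub>M (\<Pi>\<^sub>M i\<in>UNIV. count_space UNIV))"
    and const: "\<not> reading \<Longrightarrow> G False = G True"
  shows "(\<integral>\<^sup>+(u, x). (if u < f then G (x 0) (u / f, if reading then rest x else x)
        else H ((u - f) / (1 - f), x)) \<partial>factory_space p) =
    ennreal f * (ennreal p * (\<integral>\<^sup>+\<omega>. G True \<omega> \<partial>factory_space p) +
        ennreal (1 - p) * (\<integral>\<^sup>+\<omega>. G False \<omega> \<partial>factory_space p)) +
      ennreal (1 - f) * (\<integral>\<^sup>+\<omega>. H \<omega> \<partial>factory_space p)"
proof -
  interpret X: prob_space "coins p" by (rule prob_space_coins)
  let ?X = "\<Pi>\<^sub>M i\<in>(UNIV :: nat set). count_space (UNIV :: bool set)"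
  define a where "a b u = (\<integral>\<^sup>+x. G b (u, x) \<partial>coins p)" for b u
  define c where "c u = (\<integral>\<^sup>+x. H (u, x) \<partial>coins p)" for u
  have [measurable]: "a b \<in> borel_measurable borel" for b
    unfolding a_def by measurable
  have [measurable]: "c \<in> borel_measurable borel"
    unfolding c_def by measurable
  have Gx: "(\<lambda>x. G b (u, x)) \<in> borel_measurable ?X" for b u by measurable
  have inner: "(\<integral>\<^sup>+x. G (x 0) (u, if reading then rest x else x) \<partial>coins p) =
      ennreal p * a True u + ennreal (1 - p) * a False u" for u
  proof (cases reading)
    case True
    with nn_integral_coins_Suc[OF p Gx] show ?thesis by (simp add: a_def)
  next
    case False
    have "G (x 0) (u, if reading then rest x else x) = G True (u, x)" for x
      using False by (cases "x 0") (simp_all add: const)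
    then have "(\<integral>\<^sup>+x. G (x 0) (u, if reading then rest x else x) \<partial>coins p) = a True u"
      unfolding a_def by (intro nn_integral_cong)
    moreover have "a False u = a True u" unfolding a_def const[OF False] ..
    ultimately show ?thesis
      using p by (simp add: distrib_right[symmetric] ennreal_plus[symmetric] del: ennreal_plus)
  qed
  have F: "(\<lambda>\<omega>. if fst \<omega> < f then G (snd \<omega> 0) (fst \<omega> / f, if reading then rest (snd \<omega>) else snd \<omega>)
      else H ((fst \<omega> - f) / (1 - f), snd \<omega>)) \<in> borel_measurable (borel \<Otimes>\<^sub>M ?X)"
  proof -
    have [measurable]: "(\<lambda>\<omega>::real \<times> (nat \<Rightarrow> bool). if reading then rest (snd \<omega>) else snd \<omega>) \<in> borel \<Otimes>\<^sub>M ?X \<rightarrow>\<^sub>M ?X"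
      by (cases reading) simp_all
    have "(\<lambda>\<omega>. if fst \<omega> < f then G (snd \<omega> 0) (fst \<omega> / f, if reading then rest (snd \<omega>) else snd \<omega>)
        else H ((fst \<omega> - f) / (1 - f), snd \<omega>)) =
      (\<lambda>\<omega>. if fst \<omega> < f then
          (if snd \<omega> 0 then G True (fst \<omega> / f, if reading then rest (snd \<omega>) else snd \<omega>)
           else G False (fst \<omega> / f, if reading then rest (snd \<omega>) else snd \<omega>))
        else H ((fst \<omega> - f) / (1 - f), snd \<omega>))"
      by (auto simp: fun_eq_iff)
    also have "\<dots> \<in> borel_measurable (borel \<Otimes>\<^sub>M ?X)" by measurable
    finally show ?thesis .
  qed
  have "(\<integral>\<^sup>+(u, x). (if u < f then G (x 0) (u / f, if reading then rest x else x)
        else H ((u - f) / (1 - f), x)) \<partial>factory_space p) =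
      (\<integral>\<^sup>+u. (\<integral>\<^sup>+x. (if u < f then G (x 0) (u / f, if reading then rest x else x)
        else H ((u - f) / (1 - f), x)) \<partial>coins p) \<partial>uniform01)"
    using nn_integral_factory_space[OF F, of p] by (simp only: split_beta' fst_conv snd_conv)
  also have "\<dots> = (\<integral>\<^sup>+u. (if u < f then ennreal p * a True (u / f) + ennreal (1 - p) * a False (u / f)
        else c ((u - f) / (1 - f))) \<partial>uniform01)"
    by (intro nn_integral_cong) (simp add: inner c_def)
  also have "\<dots> = ennreal f * (\<integral>\<^sup>+u. ennreal p * a True u + ennreal (1 - p) * a False u \<partial>uniform01) +
      ennreal (1 - f) * (\<integral>\<^sup>+u. c u \<partial>uniform01)"
    by (rule nn_integral_uniform01_split[OF f]) auto
  also have "(\<integral>\<^sup>+u. ennreal p * a True u + ennreal (1 - p) * a False u \<partial>uniform01) =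
      ennreal p * (\<integral>\<^sup>+u. a True u \<partial>uniform01) + ennreal (1 - p) * (\<integral>\<^sup>+u. a False u \<partial>uniform01)"
    by (simp add: nn_integral_add nn_integral_cmult)
  finally show ?thesis
    by (simp add: nn_integral_factory_space a_def c_def)
qed

section \<open>Running times that are stopping times\<close>

lemma running_time_le_iff:
  "running_time A (u, x) \<le> enat t \<longleftrightarrow> (\<forall>y. (\<forall>i<t. y i = x i) \<longrightarrow> A u y = A u x)"
proof
  assume "running_time A (u, x) \<le> enat t"
  then have "running_time A (u, x) < enat (Suc t)"
    by (rule le_less_trans) simp
  then obtain s where s: "s \<in> {t. \<forall>y. (\<forall>i<t. y i = x i) \<longrightarrow> A u y = A u x}" "enat s < enat (Suc t)"
    unfolding running_time_def prod.case INF_less_iff by blast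
  then have "s \<le> t" by simp
  show "\<forall>y. (\<forall>i<t. y i = x i) \<longrightarrow> A u y = A u x"
  proof (intro allI impI)
    fix y assume "\<forall>i<t. y i = x i"
    then have "\<forall>i<s. y i = x i" using \<open>s \<le> t\<close> by simp
    with s(1) show "A u y = A u x" by blast
  qed
next
  assume "\<forall>y. (\<forall>i<t. y i = x i) \<longrightarrow> A u y = A u x"
  then show "running_time A (u, x) \<le> enat t"
    unfolding running_time_def prod.case by (intro INF_lower CollectI)
qed

text \<open>
  Compactness of the space of 0/1 sequences, by the argument of Koenig's lemma: if no \<open>k\<close> works, then
  there is an infinite sequence every prefix of which extends to counterexamples for all \<open>k\<close>.  Being true on a
  whole cylinder quantifies over uncountably many sequences; compactness replaces this by one
  number \<open>k\<close> and conditions on the first \<open>k\<close> flips.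
\<close>

lemma decided_on_cylinder_uniformly:
  fixes D :: "nat \<Rightarrow> (nat \<Rightarrow> bool) \<Rightarrow> bool"
  assumes mono: "\<And>k y. D k y \<Longrightarrow> D (Suc k) y"
    and prefix: "\<And>k y z. (\<And>i. i < k \<Longrightarrow> z i = y i) \<Longrightarrow> D k y \<Longrightarrow> D k z"
    and all: "\<And>y. (\<And>i. i < t \<Longrightarrow> y i = x i) \<Longrightarrow> \<exists>k. D k y"
  shows "\<exists>k. \<forall>y. (\<forall>i<t. y i = x i) \<longrightarrow> D k y"
proof (rule ccontr)
  assume neg: "\<not> ?thesis"
  define bad where "bad m z \<longleftrightarrow> (\<forall>k. \<exists>y. (\<forall>i<m. y i = z i) \<and> \<not> D k y)" for m z
  have D_le: "D k y \<Longrightarrow> k \<le> l \<Longrightarrow> D l y" for k l y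
    by (rule lift_Suc_mono_le[of "\<lambda>k. D k y", THEN le_boolD, rule_format]) (auto intro: mono)
  have extend: "\<exists>b. bad (Suc m) (z(m := b))" if bad: "bad m z" for m z
  proof (rule ccontr)
    assume "\<not> ?thesis"
    then obtain K where K: "\<forall>y. (\<forall>i<Suc m. y i = (z(m := b)) i) \<longrightarrow> D (K b) y" for b
      unfolding bad_def by metis
    obtain y where y: "\<forall>i<m. y i = z i" "\<not> D (max (K True) (K False)) y"
      using bad unfolding bad_def by blast
    have "\<forall>i<Suc m. y i = (z(m := y m)) i" using y(1) by (auto simp: less_Suc_eq)
    with K[of "y m"] have "D (K (y m)) y" by blast
    with D_le[of "K (y m)" y "max (K True) (K False)"] y(2) show False by (cases "y m") auto
  qed
  have "\<exists>f. \<forall>n. ((\<forall>i<t. f n i = x i) \<and> bad (t + n) (f n)) \<and> (\<forall>i<t + n. f (Suc n) i = f n i)"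
  proof (rule dependent_nat_choice)
    show "\<exists>z. (\<forall>i<t. z i = x i) \<and> bad (t + 0) z"
      using neg by (auto simp: bad_def intro!: exI[of _ x])
    fix z n assume z: "(\<forall>i<t. z i = x i) \<and> bad (t + n) z"
    then obtain b where "bad (Suc (t + n)) (z(t + n := b))" using extend by blast
    with z show "\<exists>z'. ((\<forall>i<t. z' i = x i) \<and> bad (t + Suc n) z') \<and> (\<forall>i<t + n. z' i = z i)"
      by (intro exI[of _ "z(t + n := b)"]) auto
  qed
  then obtain f where f: "\<And>n i. i < t \<Longrightarrow> f n i = x i" "\<And>n. bad (t + n) (f n)"
    "\<And>n i. i < t + n \<Longrightarrow> f (Suc n) i = f n i" by blast
  define y where "y i = f (Suc i) i" for i
  have stable: "f k i = y i" if "i < k" for i k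
    using that
  proof (induction k)
    case (Suc k)
    show ?case
    proof (cases "i = k")
      case False
      then show ?thesis using Suc f(3)[of i k] by simp
    qed (simp add: y_def)
  qed simp
  have "y i = x i" if "i < t" for i using f(1)[OF that] by (simp add: y_def)
  with all obtain k where k: "D k y" by blast
  from f(2)[of k] obtain z where z: "\<forall>i<t + k. z i = f k i" "\<not> D k z"
    unfolding bad_def by blast
  have "z i = y i" if "i < k" for i using z(1) stable[OF that] that by simp
  with prefix[of k z y] k z(2) show False by blast
qed

text \<open>
  By \<open>running_time_le_iff\<close>, the event that the running time is at most \<open>t\<close> says that the output is constant
  on the cylinder of the first \<open>t\<close> flips.  Constantly false is a countable intersection of Borel
  conditions on \<open>u\<close>, since it suffices to look at finitely supported sequences, and constantly true is a
  countable union of such by the preceding lemma.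
\<close>

lemma stopping_time_running_time:
  fixes D :: "nat \<Rightarrow> real \<Rightarrow> (nat \<Rightarrow> bool) \<Rightarrow> bool"
  assumes A: "\<And>u x. A u x \<longleftrightarrow> (\<exists>k. D k u x)"
    and mono: "\<And>k u x. D k u x \<Longrightarrow> D (Suc k) u x"
    and prefix: "\<And>k u x y. (\<And>i. i < k \<Longrightarrow> y i = x i) \<Longrightarrow> D k u x \<Longrightarrow> D k u y"
    and meas: "\<And>k x. Measurable.pred borel (\<lambda>u. D k u x)"
  shows "stopping_time natural_filtration (running_time A)"
proof (rule stopping_timeI)
  fix T :: enat
  show "Measurable.pred (natural_filtration T) (\<lambda>\<omega>. running_time A \<omega> \<le> T)"
  proof (cases T)
    case (enat t)
    define pad where "pad l = (\<lambda>i. i < length l \<and> l ! i)" for l :: "bool list"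
    have pad: "\<exists>l. \<forall>i<n. pad l i = y i" for n :: nat and y
      by (rule exI[of _ "map y [0..<n]"]) (simp add: pad_def)
    have D_le: "D k u y \<Longrightarrow> k \<le> l \<Longrightarrow> D l u y" for k l u y
      by (rule lift_Suc_mono_le[of "\<lambda>k. D k u y", THEN le_boolD, rule_format]) (auto intro: mono)
    have none: "(\<forall>y. (\<forall>i<t. y i = x i) \<longrightarrow> \<not> A u y) \<longleftrightarrow>
        (\<forall>l. (\<forall>i<t. pad l i = x i) \<longrightarrow> (\<forall>k. \<not> D k u (pad l)))" for u x
    proof safe
      fix y assume r: "\<forall>l. (\<forall>i<t. pad l i = x i) \<longrightarrow> (\<forall>k. \<not> D k u (pad l))"
        and y: "\<forall>i<t. y i = x i" "A u y"
      from y(2) obtain k where k: "D k u y" using A by blast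
      obtain l where l: "\<forall>i<max t k. pad l i = y i" using pad by blast
      then have "D k u (pad l)" using prefix[of k "pad l" y u] k by simp
      moreover have "\<forall>i<t. pad l i = x i" using l y(1) by simp
      ultimately show False using r by blast
    qed (use A in blast)
    have all: "(\<forall>y. (\<forall>i<t. y i = x i) \<longrightarrow> A u y) \<longleftrightarrow>
        (\<exists>k. \<forall>l. (\<forall>i<t. pad l i = x i) \<longrightarrow> D k u (pad l))" for u x
    proof
      assume all: "\<forall>y. (\<forall>i<t. y i = x i) \<longrightarrow> A u y"
      have "\<exists>k. \<forall>y. (\<forall>i<t. y i = x i) \<longrightarrow> D k u y"
      proof (rule decided_on_cylinder_uniformly)
        show "D k u z" if "\<And>i. i < k \<Longrightarrow> z i = y i" "D k u y" for k y z
          using that by (rule prefix)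
        show "\<exists>k. D k u y" if "\<And>i. i < t \<Longrightarrow> y i = x i" for y
          using all that A by blast
      qed (rule mono)
      then show "\<exists>k. \<forall>l. (\<forall>i<t. pad l i = x i) \<longrightarrow> D k u (pad l)" by blast
    next
      assume "\<exists>k. \<forall>l. (\<forall>i<t. pad l i = x i) \<longrightarrow> D k u (pad l)"
      then obtain k where k: "\<And>l. (\<forall>i<t. pad l i = x i) \<Longrightarrow> D k u (pad l)" by blast
      show "\<forall>y. (\<forall>i<t. y i = x i) \<longrightarrow> A u y"
      proof safe
        fix y assume y: "\<forall>i<t. y i = x i"
        obtain l where l: "\<forall>i<max t k. pad l i = y i" using pad by blast
        with y have "D k u (pad l)" by (intro k) simp
        then have "D k u y" using prefix[of k y "pad l" u] l by simp
        then show "A u y" using A by blast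
      qed
    qed
    have eq: "running_time A \<omega> \<le> T \<longleftrightarrow>
        (\<forall>l. (\<forall>i\<in>{..<t}. pad l i = snd \<omega> i) \<longrightarrow> (\<forall>k. \<not> D k (fst \<omega>) (pad l))) \<or>
        (\<exists>k. \<forall>l. (\<forall>i\<in>{..<t}. pad l i = snd \<omega> i) \<longrightarrow> D k (fst \<omega>) (pad l))" for \<omega>
    proof -
      obtain u x where \<omega>: "\<omega> = (u, x)" by (cases \<omega>)
      have "running_time A \<omega> \<le> T \<longleftrightarrow>
          (\<forall>y. (\<forall>i<t. y i = x i) \<longrightarrow> \<not> A u y) \<or> (\<forall>y. (\<forall>i<t. y i = x i) \<longrightarrow> A u y)"
        unfolding \<omega> enat running_time_le_iff by blast
      then show ?thesis unfolding none all by (simp add: \<omega> Ball_def)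
    qed
    let ?G = "{{\<omega>. fst \<omega> \<in> B} | B. B \<in> sets borel} \<union> {{\<omega>. snd \<omega> i} | i. enat i < T}
      :: (real \<times> (nat \<Rightarrow> bool)) set set"
    have N: "space (natural_filtration T) = UNIV" "sets (natural_filtration T) = sigma_sets UNIV ?G"
      unfolding natural_filtration_def by (simp_all add: space_measure_of_conv sets_measure_of_conv)
    have [measurable]: "Measurable.pred (natural_filtration T) (\<lambda>\<omega>. snd \<omega> i)" if "i \<in> {..<t}" for i
      using that unfolding pred_def N by (auto simp: enat intro!: sigma_sets.Basic)
    have [measurable]: "Measurable.pred (natural_filtration T) (\<lambda>\<omega>. D k (fst \<omega>) y)" for k y
      using meas[of k y] unfolding pred_def N by (auto intro!: sigma_sets.Basic)
    show ?thesis
      unfolding eq by measurable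
  qed simp
qed

section \<open>Markov chains driven by coin flips and one uniform variable\<close>

text \<open>
  A chain of states \<open>s\<close>: with probability \<open>threshold s\<close> the step is \<open>lo s b\<close>, where \<open>b\<close> is a coin flip if
  \<open>reading s\<close> and immaterial otherwise, else it is \<open>hi s\<close>.  The chain stops where \<open>result\<close> is defined.
  The set \<open>good\<close> contains the states that matter, for the parameters of a concrete chain may violate the
  probability bounds elsewhere.
\<close>

locale coin_machine =
  fixes good :: "'s set" and result :: "'s \<Rightarrow> bool option" and threshold :: "'s \<Rightarrow> real"
    and reading :: "'s \<Rightarrow> bool" and lo :: "'s \<Rightarrow> bool \<Rightarrow> 's" and hi :: "'s \<Rightarrow> 's"
  assumes threshold: "s \<in> good \<Longrightarrow> result s = None \<Longrightarrow> 0 < threshold s \<and> threshold s < 1"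
    and lo_good: "s \<in> good \<Longrightarrow> result s = None \<Longrightarrow> lo s b \<in> good"
    and hi_good: "s \<in> good \<Longrightarrow> result s = None \<Longrightarrow> hi s \<in> good"
    and lo_const: "s \<in> good \<Longrightarrow> result s = None \<Longrightarrow> \<not> reading s \<Longrightarrow> lo s False = lo s True"
begin

text \<open>
  State and number of flips after at most \<open>k\<close> steps.  The recursion follows the first step, so that it
  fits \<open>nn_integral_factory_space_step\<close>; the remaining flips and the rescaled \<open>u\<close> are handed on.
\<close>

primrec run :: "nat \<Rightarrow> 's \<Rightarrow> real \<Rightarrow> (nat \<Rightarrow> bool) \<Rightarrow> 's \<times> nat" where
  "run 0 s u x = (s, 0)"
| "run (Suc k) s u x =
    (if result s \<noteq> None then (s, 0)
     else if u < threshold s then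
       apsnd ((+) (of_bool (reading s)))
         (run k (lo s (x 0)) (u / threshold s) (if reading s then rest x else x))
     else run k (hi s) ((u - threshold s) / (1 - threshold s)) x)"

abbreviation state :: "nat \<Rightarrow> 's \<Rightarrow> real \<Rightarrow> (nat \<Rightarrow> bool) \<Rightarrow> 's" where
  "state k s u x \<equiv> fst (run k s u x)"

abbreviation flips :: "nat \<Rightarrow> 's \<Rightarrow> real \<Rightarrow> (nat \<Rightarrow> bool) \<Rightarrow> nat" where
  "flips k s u x \<equiv> snd (run k s u x)"

definition accepts :: "'s \<Rightarrow> real \<Rightarrow> (nat \<Rightarrow> bool) \<Rightarrow> bool" where
  "accepts s u x \<longleftrightarrow> (\<exists>k. result (state k s u x) = Some True)"

lemma run_halted: "result s \<noteq> None \<Longrightarrow> run k s u x = (s, 0)"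
  by (cases k) simp_all

lemma run_stable: "result (state k s u x) \<noteq> None \<Longrightarrow> k \<le> l \<Longrightarrow> run l s u x = run k s u x"
proof (induction k arbitrary: s u x l)
  case 0
  then show ?case by (simp add: run_halted)
next
  case (Suc k)
  then obtain l' where "l = Suc l'" "k \<le> l'" by (cases l) auto
  then show ?case using Suc.prems(1) Suc.IH[OF _ \<open>k \<le> l'\<close>] by (simp split: if_splits)
qed

lemma flips_le: "flips k s u x \<le> k"
proof (induction k arbitrary: s u x)
  case (Suc k)
  show ?case using Suc.IH le_SucI[OF Suc.IH] by simp
qed simp

lemma flips_mono: "flips k s u x \<le> flips (Suc k) s u x"
proof (induction k arbitrary: s u x)
  case (Suc k)
  show ?case by (subst (1 2) run.simps(2)) (simp add: Suc.IH del: run.simps)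
qed simp

lemma run_prefix:
  "s \<in> good \<Longrightarrow> (\<And>i. i < flips k s u x \<Longrightarrow> y i = x i) \<Longrightarrow> run k s u y = run k s u x"
proof (induction k arbitrary: s u x y)
  case (Suc k)
  consider (halted) "result s \<noteq> None"
    | (flip) "result s = None" "u < threshold s" "reading s"
    | (lo) "result s = None" "u < threshold s" "\<not> reading s"
    | (hi) "result s = None" "\<not> u < threshold s"
    by blast
  then show ?case
  proof cases
    case halted
    then show ?thesis by simp
  next
    case flip
    have "y 0 = x 0" using Suc.prems(2)[of 0] flip by simp
    moreover have "run k (lo s (x 0)) (u / threshold s) (rest y) = run k (lo s (x 0)) (u / threshold s) (rest x)"
    proof (rule Suc.IH)
      show "lo s (x 0) \<in> good" using Suc.prems(1) flip lo_good by blast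
      show "rest y i = rest x i" if "i < flips k (lo s (x 0)) (u / threshold s) (rest x)" for i
        using Suc.prems(2)[of "Suc i"] flip that by (simp add: rest_def)
    qed
    ultimately show ?thesis using flip by simp
  next
    case lo
    have const: "lo s b = lo s True" for b
      using lo_const[OF Suc.prems(1) lo(1,3)] by (cases b) simp_all
    have "run k (lo s True) (u / threshold s) y = run k (lo s True) (u / threshold s) x"
    proof (rule Suc.IH)
      show "lo s True \<in> good" using Suc.prems(1) lo lo_good by blast
      show "y i = x i" if "i < flips k (lo s True) (u / threshold s) x" for i
        using Suc.prems(2)[of i] lo const[of "x 0"] that by simp
    qed
    then show ?thesis using lo const[of "x 0"] const[of "y 0"] by simp
  next
    case hi
    have "run k (hi s) ((u - threshold s) / (1 - threshold s)) y = run k (hi s) ((u - threshold s) / (1 - threshold s)) x"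
    proof (rule Suc.IH)
      show "hi s \<in> good" using Suc.prems(1) hi hi_good by blast
      show "y i = x i" if "i < flips k (hi s) ((u - threshold s) / (1 - threshold s)) x" for i
        using Suc.prems(2)[of i] hi that by simp
    qed
    then show ?thesis using hi by simp
  qed
qed simp

lemma measurable_run [measurable]:
  "(\<lambda>\<omega>. run k s (fst \<omega>) (snd \<omega>)) \<in>
    (borel \<Otimes>\<^sub>M (\<Pi>\<^sub>M i\<in>UNIV. count_space UNIV)) \<rightarrow>\<^sub>M count_space UNIV"
proof (induction k arbitrary: s)
  case (Suc k)
  let ?X = "\<Pi>\<^sub>M i\<in>(UNIV :: nat set). count_space (UNIV :: bool set)"
  define sh :: "(nat \<Rightarrow> bool) \<Rightarrow> nat \<Rightarrow> bool" where "sh = (\<lambda>x. if reading s then rest x else x)"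
  have [measurable]: "sh \<in> ?X \<rightarrow>\<^sub>M ?X" unfolding sh_def by (cases "reading s") simp_all
  have rec: "(\<lambda>\<omega>. run k t (v (fst \<omega>)) (z (snd \<omega>))) \<in> (borel \<Otimes>\<^sub>M ?X) \<rightarrow>\<^sub>M count_space UNIV"
    if "v \<in> borel \<rightarrow>\<^sub>M borel" "z \<in> ?X \<rightarrow>\<^sub>M ?X" for t and v :: "real \<Rightarrow> real" and z
  proof -
    note [measurable] = that
    have "(\<lambda>\<omega>. (v (fst \<omega>), z (snd \<omega>))) \<in> (borel \<Otimes>\<^sub>M ?X) \<rightarrow>\<^sub>M (borel \<Otimes>\<^sub>M ?X)" by measurable
    from measurable_compose[OF this Suc.IH[of t]] show ?thesis by simp
  qed
  have hd [measurable]: "Measurable.pred (borel \<Otimes>\<^sub>M ?X) (\<lambda>\<omega>::real \<times> (nat \<Rightarrow> bool). snd \<omega> 0)"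
    by (rule measurable_compose[OF measurable_snd measurable_component_singleton]) simp
  have lo: "(\<lambda>\<omega>. if snd \<omega> 0 then run k (lo s True) (fst \<omega> / threshold s) (sh (snd \<omega>))
      else run k (lo s False) (fst \<omega> / threshold s) (sh (snd \<omega>))) \<in> (borel \<Otimes>\<^sub>M ?X) \<rightarrow>\<^sub>M count_space UNIV"
    by (intro measurable_If rec[of "\<lambda>u. u / threshold s" sh]) measurable
  have hi: "(\<lambda>\<omega>. run k (hi s) ((fst \<omega> - threshold s) / (1 - threshold s)) (snd \<omega>)) \<in> (borel \<Otimes>\<^sub>M ?X) \<rightarrow>\<^sub>M count_space UNIV"
    by (rule rec[of "\<lambda>u. (u - threshold s) / (1 - threshold s)" "\<lambda>x. x"]) measurable
  have "(\<lambda>\<omega>. run (Suc k) s (fst \<omega>) (snd \<omega>)) =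
    (\<lambda>\<omega>. if result s \<noteq> None then (s, 0)
       else if fst \<omega> < threshold s then
         apsnd ((+) (of_bool (reading s)))
           (if snd \<omega> 0 then run k (lo s True) (fst \<omega> / threshold s) (sh (snd \<omega>))
            else run k (lo s False) (fst \<omega> / threshold s) (sh (snd \<omega>)))
       else run k (hi s) ((fst \<omega> - threshold s) / (1 - threshold s)) (snd \<omega>))"
    by (auto simp: fun_eq_iff sh_def)
  also have "\<dots> \<in> (borel \<Otimes>\<^sub>M ?X) \<rightarrow>\<^sub>M count_space UNIV"
    using measurable_compose[OF lo measurable_count_space] hi
    by (cases "result s = None") (auto intro!: measurable_If)
  finally show ?case .
qed simp

definition mean :: "real \<Rightarrow> ('s \<Rightarrow> real) \<Rightarrow> 's \<Rightarrow> real" where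
  "mean p h s = threshold s * (p * h (lo s True) + (1 - p) * h (lo s False)) + (1 - threshold s) * h (hi s)"

text \<open>
  The expectation of \<open>\<phi>\<close> at the final state plus \<open>c\<close> times the number of flips, computed by the backward
  equations.  The choices of \<open>\<phi>\<close> and \<open>c\<close> cover the probability of acceptance, that of not having halted, and the
  mean number of flips, so that \<open>nn_integral_run\<close> has to be proved only once.
\<close>

primrec expect :: "real \<Rightarrow> real \<Rightarrow> ('s \<Rightarrow> real) \<Rightarrow> nat \<Rightarrow> 's \<Rightarrow> real" where
  "expect p c \<phi> 0 s = \<phi> s"
| "expect p c \<phi> (Suc k) s =
    (if result s \<noteq> None then \<phi> s
     else c * (threshold s * of_bool (reading s)) + mean p (expect p c \<phi> k) s)"

lemma mean_mono:
  assumes "0 \<le> p" "p \<le> 1" "s \<in> good" "result s = None" "\<And>t. t \<in> good \<Longrightarrow> h t \<le> h' t"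
  shows "mean p h s \<le> mean p h' s"
  unfolding mean_def using assms threshold[of s] lo_good[of s] hi_good[of s]
  by (intro add_mono mult_left_mono) auto

lemma mean_linear: "mean p (\<lambda>t. a * h t + b * h' t) s = a * mean p h s + b * mean p h' s"
  unfolding mean_def by (simp add: algebra_simps)

lemma mean_const: "mean p (\<lambda>t. a) s = a"
  unfolding mean_def by (simp add: algebra_simps)

lemma expect_nonneg:
  assumes "0 \<le> p" "p \<le> 1" "0 \<le> c" "\<And>t. t \<in> good \<Longrightarrow> 0 \<le> \<phi> t"
  shows "s \<in> good \<Longrightarrow> 0 \<le> expect p c \<phi> k s"
proof (induction k arbitrary: s)
  case (Suc k)
  show ?case
  proof (cases "result s = None")
    case True
    have "mean p (\<lambda>_. 0) s \<le> mean p (expect p c \<phi> k) s"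
      using Suc True assms by (intro mean_mono) auto
    then show ?thesis using True assms threshold[OF Suc.prems] by (simp add: mean_const)
  qed (use assms Suc.prems in simp)
qed (use assms in simp)

lemma nn_integral_run:
  assumes p: "0 \<le> p" "p \<le> 1" and c: "0 \<le> c" and \<phi>: "\<And>t. t \<in> good \<Longrightarrow> 0 \<le> \<phi> t"
  shows "s \<in> good \<Longrightarrow>
    (\<integral>\<^sup>+(u, x). ennreal (\<phi> (state k s u x) + c * real (flips k s u x)) \<partial>factory_space p) =
    ennreal (expect p c \<phi> k s)"
proof (induction k arbitrary: s)
  case 0
  interpret prob_space "factory_space p" by (rule prob_space_factory_space)
  show ?case using emeasure_space_1 by (simp add: split_beta')
next
  case (Suc k)
  interpret prob_space "factory_space p" by (rule prob_space_factory_space)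
  show ?case
  proof (cases "result s = None")
    case False
    then show ?thesis using emeasure_space_1 by (simp add: split_beta' run_halted)
  next
    case True
    note t = threshold[OF Suc.prems True]
    note nn = expect_nonneg[of p c \<phi>, OF p c \<phi>]
    define r :: real where "r = of_bool (reading s)"
    define H where "H t = (\<lambda>\<omega>. ennreal (\<phi> (state k t (fst \<omega>) (snd \<omega>)) + c * real (flips k t (fst \<omega>) (snd \<omega>))))" for t
    define G where "G b = (\<lambda>\<omega>. ennreal (\<phi> (state k (lo s b) (fst \<omega>) (snd \<omega>)) +
      c * (real (flips k (lo s b) (fst \<omega>) (snd \<omega>)) + r)))" for b
    have H: "(\<integral>\<^sup>+\<omega>. H t \<omega> \<partial>factory_space p) = ennreal (expect p c \<phi> k t)" if "t \<in> good" for t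
      using Suc.IH[OF that] by (simp add: H_def split_beta')
    have mH: "H t \<in> borel_measurable (borel \<Otimes>\<^sub>M (\<Pi>\<^sub>M i\<in>UNIV. count_space UNIV))" for t
      unfolding H_def by (rule measurable_compose[OF measurable_run]) simp
    have mG: "G b \<in> borel_measurable (borel \<Otimes>\<^sub>M (\<Pi>\<^sub>M i\<in>UNIV. count_space UNIV))" for b
      unfolding G_def by (rule measurable_compose[OF measurable_run]) simp
    have mH': "H t \<in> borel_measurable (factory_space p)" for t
      using mH[of t] measurable_cong_sets[OF sets_factory_space refl] by blast
    have st: "state k t u x \<in> good" if "t \<in> good" for t u x
      using that by (induction k arbitrary: t u x) (auto simp: lo_good hi_good)
    have G: "(\<integral>\<^sup>+\<omega>. G b \<omega> \<partial>factory_space p) = ennreal (expect p c \<phi> k (lo s b) + c * r)" for b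
    proof -
      have g: "lo s b \<in> good" using lo_good[OF Suc.prems True] .
      have "(\<integral>\<^sup>+\<omega>. G b \<omega> \<partial>factory_space p) = (\<integral>\<^sup>+\<omega>. H (lo s b) \<omega> + ennreal (c * r) \<partial>factory_space p)"
        using \<phi>[OF st[OF g]] c by (intro nn_integral_cong)
          (simp add: G_def H_def r_def distrib_left add.assoc[symmetric] ennreal_plus[symmetric] del: ennreal_plus)
      also have "\<dots> = ennreal (expect p c \<phi> k (lo s b)) + ennreal (c * r)"
        using H[OF g] emeasure_space_1 mH'[of "lo s b"] by (subst nn_integral_add) simp_all
      finally show ?thesis using nn[OF _ g] c by (simp add: r_def)
    qed
    have "(\<integral>\<^sup>+(u, x). ennreal (\<phi> (state (Suc k) s u x) + c * real (flips (Suc k) s u x)) \<partial>factory_space p) =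
      (\<integral>\<^sup>+(u, x). (if u < threshold s then G (x 0) (u / threshold s, if reading s then rest x else x)
        else H (hi s) ((u - threshold s) / (1 - threshold s), x)) \<partial>factory_space p)"
      using True by (intro nn_integral_cong) (auto simp: G_def H_def r_def add.commute)
    also have "\<dots> = ennreal (threshold s) * (ennreal p * (\<integral>\<^sup>+\<omega>. G True \<omega> \<partial>factory_space p) +
        ennreal (1 - p) * (\<integral>\<^sup>+\<omega>. G False \<omega> \<partial>factory_space p)) +
      ennreal (1 - threshold s) * (\<integral>\<^sup>+\<omega>. H (hi s) \<omega> \<partial>factory_space p)"
      using t p lo_const[OF Suc.prems True] by (intro nn_integral_factory_space_step mG mH) (auto simp: G_def)
    also have "\<dots> = ennreal (threshold s * (p * (expect p c \<phi> k (lo s True) + c * r) +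
        (1 - p) * (expect p c \<phi> k (lo s False) + c * r)) + (1 - threshold s) * expect p c \<phi> k (hi s))"
    proof -
      have "0 \<le> expect p c \<phi> k (lo s b) + c * r" "0 \<le> expect p c \<phi> k (hi s)" for b
        using nn lo_good[OF Suc.prems True] hi_good[OF Suc.prems True] c by (simp_all add: r_def)
      then show ?thesis
        unfolding G H[OF hi_good[OF Suc.prems True]] using p t
        by (simp add: ennreal_plus[symmetric] ennreal_mult[symmetric] del: ennreal_plus)
    qed
    also have "\<dots> = ennreal (expect p c \<phi> (Suc k) s)"
      using True by (simp add: mean_def r_def algebra_simps)
    finally show ?thesis .
  qed
qed

end

section \<open>Harmonic functions give the output law, potentials the running time\<close>

context coin_machine
begin

definition harmonic :: "real \<Rightarrow> ('s \<Rightarrow> real) \<Rightarrow> bool" where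
  "harmonic p v \<longleftrightarrow> (\<forall>s\<in>good. 0 \<le> v s \<and> v s \<le> 1 \<and>
     (\<forall>b. result s = Some b \<longrightarrow> v s = of_bool b) \<and> (result s = None \<longrightarrow> v s = mean p v s))"

text \<open>
  A supersolution of the equations for an expected total charge: 1 for a decision in favour of a flip,
  \<open>\<eta>\<close> for any other step, except that halting by \<open>hi\<close> is free.  Because of the exception, a state whose
  only steps without a flip halt by \<open>hi\<close> can have its exact number of flips as potential.
\<close>

definition potential :: "real \<Rightarrow> real \<Rightarrow> ('s \<Rightarrow> real) \<Rightarrow> bool" where
  "potential p \<eta> g \<longleftrightarrow> (\<forall>s\<in>good. 0 \<le> g s \<and> (result s = None \<longrightarrow>
     threshold s * (if reading s then 1 else \<eta>) + (1 - threshold s) * (if result (hi s) = None then \<eta> else 0) +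
       mean p g s \<le> g s))"

abbreviation accepting :: "'s \<Rightarrow> real" where
  "accepting s \<equiv> of_bool (result s = Some True)"

abbreviation undecided :: "'s \<Rightarrow> real" where
  "undecided s \<equiv> of_bool (result s = None)"

lemma expect_accepting_le:
  assumes p: "0 \<le> p" "p \<le> 1" and v: "harmonic p v"
  shows "s \<in> good \<Longrightarrow> expect p 0 accepting k s \<le> v s"
proof (induction k arbitrary: s)
  case 0
  then show ?case using v by (auto simp: harmonic_def)
next
  case (Suc k)
  show ?case
  proof (cases "result s")
    case None
    have "mean p (expect p 0 accepting k) s \<le> mean p v s"
      using p Suc None by (intro mean_mono) auto
    then show ?thesis using None v Suc.prems by (simp add: harmonic_def)
  next
    case (Some b)
    then show ?thesis using v Suc.prems by (simp add: harmonic_def)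
  qed
qed

lemma expect_accepting_ge:
  assumes p: "0 \<le> p" "p \<le> 1" and v: "harmonic p v"
  shows "s \<in> good \<Longrightarrow> v s \<le> expect p 0 accepting k s + expect p 0 undecided k s"
proof (induction k arbitrary: s)
  case 0
  then show ?case using v by (cases "result s") (auto simp: harmonic_def)
next
  case (Suc k)
  show ?case
  proof (cases "result s")
    case None
    have "mean p v s \<le> mean p (\<lambda>t. 1 * expect p 0 accepting k t + 1 * expect p 0 undecided k t) s"
      using p Suc None by (intro mean_mono) auto
    then show ?thesis unfolding mean_linear using None v Suc.prems by (simp add: harmonic_def)
  next
    case (Some b)
    then show ?thesis using v Suc.prems by (simp add: harmonic_def)
  qed
qed

text \<open>
  A run that has not halted after \<open>k\<close> steps has been charged at least \<open>k * \<eta> / (1 + \<eta>)\<close>, and the potential bounds the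
  mean charge.
\<close>

lemma expect_undecided_le:
  assumes p: "0 \<le> p" "p \<le> 1" and \<eta>: "0 \<le> \<eta>" and g: "potential p \<eta> g"
  shows "s \<in> good \<Longrightarrow> \<eta> * (k * expect p 0 undecided k s) \<le> (1 + \<eta>) * g s"
proof (induction k arbitrary: s)
  case 0
  then show ?case using \<eta> g by (auto simp: potential_def)
next
  case (Suc k)
  have g0: "0 \<le> g s" using g Suc.prems by (simp add: potential_def)
  show ?case
  proof (cases "result s")
    case None
    note t = threshold[OF Suc.prems None]
    let ?u = "expect p 0 undecided k"
    let ?h = "of_bool (result (hi s) = None) :: real"
    have u: "?u t \<le> of_bool (result t = None)" if "t \<in> good" for t
      using that
    proof (induction k arbitrary: t)
      case (Suc k)
      show ?case
      proof (cases "result t = None")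
        case True
        have "mean p (expect p 0 undecided k) t \<le> mean p (\<lambda>_. 1) t"
          using p True Suc.prems by (intro mean_mono order_trans[OF Suc.IH]) auto
        then show ?thesis using True by (simp add: mean_const)
      qed simp
    qed simp
    have u1: "?u t \<le> 1" if "t \<in> good" for t
      using u[OF that] by (rule order_trans) simp
    have "mean p ?u s \<le> threshold s * (p * 1 + (1 - p) * 1) + (1 - threshold s) * ?h"
      unfolding mean_def using t p lo_good[OF Suc.prems None] hi_good[OF Suc.prems None]
      by (intro add_mono mult_left_mono u u1) auto
    then have "\<eta> * mean p ?u s \<le> \<eta> * (threshold s + (1 - threshold s) * ?h)"
      using \<eta> by (intro mult_left_mono) auto
    \<comment> \<open>A flip is charged 1 and has to cover one unit of \<open>\<eta>\<close>; the factor \<open>1 + \<eta>\<close> makes room for it even if \<open>\<eta> > 1\<close>.\<close>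
    also have "\<dots> \<le> (1 + \<eta>) *
        (threshold s * (if reading s then 1 else \<eta>) + (1 - threshold s) * (if result (hi s) = None then \<eta> else 0))"
    proof -
      have "0 \<le> \<eta> * \<eta> * threshold s" "0 \<le> \<eta> * \<eta> * (1 - threshold s)" using \<eta> t by auto
      then show ?thesis using t \<eta> by (auto simp: algebra_simps)
    qed
    finally have *: "\<eta> * mean p ?u s \<le> \<dots>" .
    have "mean p (\<lambda>t. \<eta> * k * ?u t + 0 * ?u t) s \<le> mean p (\<lambda>t. (1 + \<eta>) * g t + 0 * g t) s"
      using p Suc None by (intro mean_mono) (auto simp: mult.assoc)
    then have "\<eta> * k * mean p ?u s \<le> (1 + \<eta>) * mean p g s" unfolding mean_linear by simp
    with * have "\<eta> * k * mean p ?u s + \<eta> * mean p ?u s \<le> (1 + \<eta>) *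
        (threshold s * (if reading s then 1 else \<eta>) + (1 - threshold s) * (if result (hi s) = None then \<eta> else 0) +
          mean p g s)" by (simp only: distrib_left)
    also have "\<dots> \<le> (1 + \<eta>) * g s"
      using g Suc.prems None \<eta> by (intro mult_left_mono) (auto simp: potential_def)
    finally show ?thesis using None by (simp add: algebra_simps)
  next
    case (Some b)
    then show ?thesis using g0 \<eta> by simp
  qed
qed

lemma expect_flips_le:
  assumes p: "0 \<le> p" "p \<le> 1" and \<eta>: "0 \<le> \<eta>" and g: "potential p \<eta> g"
  shows "s \<in> good \<Longrightarrow> expect p 1 (\<lambda>_. 0) k s \<le> g s"
proof (induction k arbitrary: s)
  case 0
  then show ?case using g by (auto simp: potential_def)
next
  case (Suc k)
  have g0: "0 \<le> g s" using g Suc.prems by (simp add: potential_def)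
  show ?case
  proof (cases "result s")
    case None
    note t = threshold[OF Suc.prems None]
    have "threshold s * of_bool (reading s) + mean p (expect p 1 (\<lambda>_. 0) k) s \<le>
        (threshold s * (if reading s then 1 else \<eta>) + (1 - threshold s) * (if result (hi s) = None then \<eta> else 0)) +
          mean p g s"
      using p \<eta> t Suc None by (intro add_mono mean_mono) (auto intro!: add_nonneg_nonneg)
    also have "\<dots> \<le> g s" using g Suc.prems None by (simp add: potential_def)
    finally show ?thesis using None by simp
  qed (use g0 in simp)
qed

lemma accepts_iff:
  assumes "result (state k s u x) \<noteq> None"
  shows "accepts s u x \<longleftrightarrow> result (state k s u x) = Some True"
proof
  assume "accepts s u x"
  then obtain l where l: "result (state l s u x) = Some True" by (auto simp: accepts_def)
  have "run (max k l) s u x = run k s u x" "run (max k l) s u x = run l s u x"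
    using assms l by (auto intro: run_stable)
  with l show "result (state k s u x) = Some True" by simp
qed (auto simp: accepts_def)

text \<open>
  Only an inequality: a run may read flips on which its output turns out not to depend.
\<close>

lemma running_time_le_flips:
  assumes "s \<in> good" "result (state k s u x) \<noteq> None"
  shows "running_time (accepts s) (u, x) \<le> enat (flips k s u x)"
  unfolding running_time_le_iff
proof (intro allI impI)
  fix y assume "\<forall>i<flips k s u x. y i = x i"
  then have "run k s u y = run k s u x" using assms(1) by (intro run_prefix) auto
  then show "accepts s u y = accepts s u x"
    using accepts_iff[of k s u x] accepts_iff[of k s u y] assms(2) by simp
qed

lemma stopping_time_accepts:
  assumes "s \<in> good"
  shows "stopping_time natural_filtration (running_time (accepts s))"
proof (rule stopping_time_running_time[where D = "\<lambda>k u x. result (state k s u x) = Some True"])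
  fix k u and x y :: "nat \<Rightarrow> bool"
  show "accepts s u x \<longleftrightarrow> (\<exists>k. result (state k s u x) = Some True)" by (rule accepts_def)
  show "result (state (Suc k) s u x) = Some True" if "result (state k s u x) = Some True"
    using run_stable[of k s u x "Suc k"] that by (simp del: run.simps)
  show "result (state k s u y) = Some True"
    if "\<And>i. i < k \<Longrightarrow> y i = x i" "result (state k s u x) = Some True"
    using run_prefix[OF assms, of k u x y] that flips_le[of k s u x] by simp
  have "(\<lambda>u. (u, x)) \<in> borel \<rightarrow>\<^sub>M (borel \<Otimes>\<^sub>M (\<Pi>\<^sub>M i\<in>UNIV. count_space UNIV))"
    by (intro measurable_Pair measurable_const) (simp_all add: space_PiM)
  from measurable_compose[OF measurable_compose[OF this measurable_run[of k s]] measurable_count_space]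
  show "Measurable.pred borel (\<lambda>u. result (state k s u x) = Some True)" by simp
qed

lemma measurable_state_pred [measurable]:
  "Measurable.pred (factory_space p) (\<lambda>\<omega>. P (run k s (fst \<omega>) (snd \<omega>)))"
proof -
  have "Measurable.pred (borel \<Otimes>\<^sub>M (\<Pi>\<^sub>M i\<in>UNIV. count_space UNIV)) (\<lambda>\<omega>. P (run k s (fst \<omega>) (snd \<omega>)))"
    by (rule measurable_compose[OF measurable_run]) simp
  then show ?thesis using measurable_cong_sets[OF sets_factory_space refl] by blast
qed

lemma emeasure_state:
  assumes "0 \<le> p" "p \<le> 1" "s \<in> good"
  shows "emeasure (factory_space p) {\<omega>. P (state k s (fst \<omega>) (snd \<omega>))} =
    ennreal (expect p 0 (\<lambda>t. of_bool (P t)) k s)"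
proof -
  have "emeasure (factory_space p) {\<omega>. P (state k s (fst \<omega>) (snd \<omega>))} =
    (\<integral>\<^sup>+\<omega>. indicator {\<omega>. P (state k s (fst \<omega>) (snd \<omega>))} \<omega> \<partial>factory_space p)"
    using measurable_state_pred[where p = p and s = s and k = k and P = "\<lambda>r. P (fst r)"]
    by (intro nn_integral_indicator[symmetric]) (simp add: pred_def)
  also have "\<dots> = (\<integral>\<^sup>+(u, x). ennreal (of_bool (P (state k s u x)) + 0 * real (flips k s u x)) \<partial>factory_space p)"
    by (intro nn_integral_cong) (auto simp: indicator_def)
  finally show ?thesis using nn_integral_run[of p 0 "\<lambda>t. of_bool (P t)" s k] assms by simp
qed

context
  fixes p \<eta> :: real and v g :: "'s \<Rightarrow> real" and s :: 's
  assumes p: "0 \<le> p" "p \<le> 1" and \<eta>: "0 < \<eta>"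
    and v: "harmonic p v" and g: "potential p \<eta> g" and s: "s \<in> good"
begin

interpretation prob_space "factory_space p" by (rule prob_space_factory_space)

lemma undecided_tendsto_0: "(\<lambda>k. expect p 0 undecided k s) \<longlonglongrightarrow> 0"
proof (rule tendsto_sandwich)
  show "\<forall>\<^sub>F k in sequentially. 0 \<le> expect p 0 undecided k s"
    using p s by (intro always_eventually allI expect_nonneg) auto
  show "\<forall>\<^sub>F k in sequentially. expect p 0 undecided k s \<le> ((1 + \<eta>) * g s / \<eta>) * inverse (real k)"
    using eventually_gt_at_top[of 0]
  proof eventually_elim
    case (elim k)
    with expect_undecided_le[OF p _ g s, of k] \<eta> show ?case
      by (simp add: field_simps)
  qed
  have "(\<lambda>k. ((1 + \<eta>) * g s / \<eta>) * inverse (real k)) \<longlonglongrightarrow> ((1 + \<eta>) * g s / \<eta>) * 0"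
    by (intro tendsto_mult tendsto_const lim_inverse_n)
  then show "(\<lambda>k. ((1 + \<eta>) * g s / \<eta>) * inverse (real k)) \<longlonglongrightarrow> 0" by simp
qed simp

lemma AE_halts: "AE \<omega> in factory_space p. \<exists>k. result (state k s (fst \<omega>) (snd \<omega>)) \<noteq> None"
proof -
  let ?N = "{\<omega>. \<forall>k. result (state k s (fst \<omega>) (snd \<omega>)) = None}"
  have N: "?N \<in> sets (factory_space p)"
  proof -
    have "Measurable.pred (factory_space p) (\<lambda>\<omega>. \<forall>k. result (state k s (fst \<omega>) (snd \<omega>)) = None)"
      by (intro pred_intros_countable measurable_state_pred)
    then show ?thesis by (simp add: pred_def)
  qed
  have "emeasure (factory_space p) ?N \<le> ennreal (expect p 0 undecided k s)" for k
  proof -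
    have "{\<omega>. result (state k s (fst \<omega>) (snd \<omega>)) = None} \<in> sets (factory_space p)"
      using measurable_state_pred[where p = p and s = s and k = k and P = "\<lambda>r. result (fst r) = None"]
      by (simp add: pred_def)
    then have "emeasure (factory_space p) ?N \<le>
        emeasure (factory_space p) {\<omega>. result (state k s (fst \<omega>) (snd \<omega>)) = None}"
      by (intro emeasure_mono) auto
    then show ?thesis using emeasure_state[OF p s, of "\<lambda>t. result t = None" k] by simp
  qed
  moreover have "(\<lambda>k. ennreal (expect p 0 undecided k s)) \<longlonglongrightarrow> ennreal 0"
    by (rule tendsto_ennrealI[OF undecided_tendsto_0])
  ultimately have "emeasure (factory_space p) ?N \<le> ennreal 0"
    by (intro LIMSEQ_le_const) auto
  then have "?N \<in> null_sets (factory_space p)" using N by auto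
  from AE_not_in[OF this] show ?thesis by simp
qed

lemma pred_accepts: "Measurable.pred (factory_space p) (\<lambda>\<omega>. accepts s (fst \<omega>) (snd \<omega>))"
  unfolding accepts_def by (intro pred_intros_countable measurable_state_pred)

text \<open>
  After \<open>k\<close> steps the probability of having accepted is at most \<open>v s\<close>, and it falls short by no more than the
  probability of not having halted, which tends to 0.
\<close>

lemma emeasure_accepts: "emeasure (factory_space p) {\<omega>. accepts s (fst \<omega>) (snd \<omega>)} = ennreal (v s)"
proof -
  let ?E = "\<lambda>k. {\<omega>. result (state k s (fst \<omega>) (snd \<omega>)) = Some True}"
  have E: "?E k \<in> sets (factory_space p)" for k
    using measurable_state_pred[where p = p and s = s and k = k and P = "\<lambda>r. result (fst r) = Some True"]
      by (simp add: pred_def)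
  have "incseq ?E"
  proof (intro incseq_SucI subsetI CollectI)
    fix k \<omega> assume "\<omega> \<in> ?E k"
    then show "result (state (Suc k) s (fst \<omega>) (snd \<omega>)) = Some True"
      using run_stable[of k s "fst \<omega>" "snd \<omega>" "Suc k"] by (simp del: run.simps)
  qed
  have 1: "(\<lambda>k. emeasure (factory_space p) (?E k)) \<longlonglongrightarrow> emeasure (factory_space p) (\<Union>k. ?E k)"
    using E \<open>incseq ?E\<close> by (intro Lim_emeasure_incseq) auto
  have 2: "(\<lambda>k. emeasure (factory_space p) (?E k)) \<longlonglongrightarrow> ennreal (v s)"
  proof -
    have "(\<lambda>k. expect p 0 accepting k s) \<longlonglongrightarrow> v s"
    proof (rule tendsto_sandwich)
      show "(\<lambda>k. v s - expect p 0 undecided k s) \<longlonglongrightarrow> v s"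
        using tendsto_diff[OF tendsto_const undecided_tendsto_0, of "v s"] by simp
      show "\<forall>\<^sub>F k in sequentially. v s - expect p 0 undecided k s \<le> expect p 0 accepting k s"
        using expect_accepting_ge[OF p v s] by (simp add: algebra_simps)
      show "\<forall>\<^sub>F k in sequentially. expect p 0 accepting k s \<le> v s"
        using expect_accepting_le[OF p v s] by simp
    qed simp
    from tendsto_ennrealI[OF this] show ?thesis
      using emeasure_state[OF p s, of "\<lambda>t. result t = Some True"] by simp
  qed
  have "(\<Union>k. ?E k) = {\<omega>. accepts s (fst \<omega>) (snd \<omega>)}" unfolding accepts_def by blast
  with LIMSEQ_unique[OF 1 2] show ?thesis by simp
qed

lemma distr_accepts:
  "distr (factory_space p) (count_space UNIV) (\<lambda>(u, x). accepts s u x) =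
    measure_pmf (bernoulli_pmf (v s))"
proof (rule measure_eqI_countable[of _ UNIV])
  let ?D = "distr (factory_space p) (count_space UNIV) (\<lambda>(u, x). accepts s u x)"
  have meas: "(\<lambda>(u, x). accepts s u x) \<in> factory_space p \<rightarrow>\<^sub>M count_space UNIV"
    using pred_accepts by (simp add: split_beta')
  have vs: "0 \<le> v s" "v s \<le> 1" using v s by (auto simp: harmonic_def)
  interpret D: prob_space ?D using meas by (rule prob_space_distr)
  have "(\<lambda>(u, x). accepts s u x) -` {True} \<inter> space (factory_space p) =
      {\<omega>. accepts s (fst \<omega>) (snd \<omega>)}"
    by (simp add: vimage_def split_beta')
  then have "emeasure ?D {True} = emeasure (factory_space p) {\<omega>. accepts s (fst \<omega>) (snd \<omega>)}"
    using emeasure_distr[OF meas, of "{True}"] by simp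
  then have T: "emeasure ?D {True} = ennreal (v s)" using emeasure_accepts by simp
  have "{False} = space ?D - {True}" by auto
  then have "emeasure ?D {False} = emeasure ?D (space ?D) - emeasure ?D {True}"
    using emeasure_compl[of "{True}" ?D] T by simp
  then have F: "emeasure ?D {False} = ennreal (1 - v s)"
    using D.emeasure_space_1 T vs by (simp add: ennreal_minus flip: ennreal_1)
  show "emeasure ?D {b} = emeasure (measure_pmf (bernoulli_pmf (v s))) {b}" for b
    using T F vs by (cases b) (simp_all add: emeasure_pmf_single)
qed auto

lemma AE_running_time_finite: "AE \<omega> in factory_space p. running_time (accepts s) \<omega> < \<infinity>"
  using AE_halts
proof eventually_elim
  case (elim \<omega>)
  then obtain k where "result (state k s (fst \<omega>) (snd \<omega>)) \<noteq> None" by blast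
  from running_time_le_flips[OF s this]
  have "running_time (accepts s) \<omega> \<le> enat (flips k s (fst \<omega>) (snd \<omega>))" by simp
  then show ?case by (rule le_less_trans) simp
qed

lemma nn_integral_running_time:
  "(\<integral>\<^sup>+\<omega>. ennreal_of_enat (running_time (accepts s) \<omega>) \<partial>factory_space p) \<le> ennreal (g s)"
proof -
  let ?f = "\<lambda>k \<omega>. ennreal (real (flips k s (fst \<omega>) (snd \<omega>)))"
  have "AE \<omega> in factory_space p. ennreal_of_enat (running_time (accepts s) \<omega>) \<le> (SUP k. ?f k \<omega>)"
    using AE_halts
  proof eventually_elim
    case (elim \<omega>)
    then obtain k where k: "result (state k s (fst \<omega>) (snd \<omega>)) \<noteq> None" by blast
    have "ennreal_of_enat (running_time (accepts s) \<omega>) \<le> ennreal_of_enat (enat (flips k s (fst \<omega>) (snd \<omega>)))"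
      using running_time_le_flips[OF s k] by (simp only: ennreal_of_enat_le_iff prod.collapse)
    also have "\<dots> = ?f k \<omega>" by (simp add: ennreal_of_nat_eq_real_of_nat)
    also have "\<dots> \<le> (SUP k. ?f k \<omega>)" by (rule SUP_upper) simp
    finally show ?case .
  qed
  then have "(\<integral>\<^sup>+\<omega>. ennreal_of_enat (running_time (accepts s) \<omega>) \<partial>factory_space p) \<le>
      (\<integral>\<^sup>+\<omega>. (SUP k. ?f k \<omega>) \<partial>factory_space p)"
    by (rule nn_integral_mono_AE)
  also have "\<dots> = (SUP k. \<integral>\<^sup>+\<omega>. ?f k \<omega> \<partial>factory_space p)"
  proof (rule nn_integral_monotone_convergence_SUP)
    show "incseq ?f" by (intro incseq_SucI le_funI ennreal_leI of_nat_mono flips_mono)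
    fix k
    have "?f k \<in> borel_measurable (borel \<Otimes>\<^sub>M (\<Pi>\<^sub>M i\<in>UNIV. count_space UNIV))"
      by (rule measurable_compose[OF measurable_run]) simp
    then show "?f k \<in> borel_measurable (factory_space p)"
      using measurable_cong_sets[OF sets_factory_space refl] by blast
  qed
  also have "\<dots> \<le> ennreal (g s)"
  proof (rule SUP_least)
    fix k
    have "(\<integral>\<^sup>+\<omega>. ?f k \<omega> \<partial>factory_space p) = ennreal (expect p 1 (\<lambda>_. 0) k s)"
      using nn_integral_run[of p 1 "\<lambda>_. 0" s k] p s by (simp add: split_beta')
    also have "\<dots> \<le> ennreal (g s)"
      using expect_flips_le[OF p _ g s] \<eta> by (intro ennreal_leI) simp
    finally show "(\<integral>\<^sup>+\<omega>. ?f k \<omega> \<partial>factory_space p) \<le> ennreal (g s)" .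
  qed
  finally show ?thesis .
qed

end

end

section \<open>The chain for small means and its program\<close>

primrec loopfree :: "prog \<Rightarrow> bool" where
  "loopfree Skip \<longleftrightarrow> True"
| "loopfree (Assign k a) \<longleftrightarrow> True"
| "loopfree (Flip k) \<longleftrightarrow> True"
| "loopfree (Seq P Q) \<longleftrightarrow> loopfree P \<and> loopfree Q"
| "loopfree (IfLess a b P Q) \<longleftrightarrow> loopfree P \<and> loopfree Q"
| "loopfree (WhileLess a b P) \<longleftrightarrow> False"

text \<open>
  A loop-free program is a total function on configurations; loops get a dummy value.
\<close>

primrec effect :: "(nat \<Rightarrow> bool) \<Rightarrow> prog \<Rightarrow> (nat \<Rightarrow> real) \<times> nat \<Rightarrow> (nat \<Rightarrow> real) \<times> nat" where
  "effect x Skip \<sigma> = \<sigma>"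
| "effect x (Assign k a) \<sigma> = ((fst \<sigma>)(k := rval a (fst \<sigma>)), snd \<sigma>)"
| "effect x (Flip k) \<sigma> = ((fst \<sigma>)(k := of_bool (x (snd \<sigma>))), Suc (snd \<sigma>))"
| "effect x (Seq P Q) \<sigma> = effect x Q (effect x P \<sigma>)"
| "effect x (IfLess a b P Q) \<sigma> = (if rval a (fst \<sigma>) < rval b (fst \<sigma>) then effect x P \<sigma> else effect x Q \<sigma>)"
| "effect x (WhileLess a b P) \<sigma> = \<sigma>"

lemma exec_imp_effect: "exec x P \<sigma> \<sigma>' \<Longrightarrow> loopfree P \<Longrightarrow> \<sigma>' = effect x P \<sigma>"
  by (induction rule: exec.induct) auto

lemma exec_effect: "loopfree P \<Longrightarrow> exec x P \<sigma> (effect x P \<sigma>)"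
proof (induction P arbitrary: \<sigma>)
  case Skip
  show ?case by (simp add: exec.Skip)
next
  case (Assign k a)
  show ?case by (cases \<sigma>) (simp add: exec.Assign)
next
  case (Flip k)
  show ?case by (cases \<sigma>) (simp only: effect.simps fst_conv snd_conv exec.Flip)
next
  case (Seq P Q)
  then show ?case using exec.Seq[OF Seq.IH] by simp
next
  case (IfLess a b P Q)
  then show ?case
    by (cases "rval a (fst \<sigma>) < rval b (fst \<sigma>)") (simp_all add: exec.IfTrue exec.IfFalse)
qed simp

inductive_cases exec_SeqE: "exec x (Seq P Q) \<sigma> \<tau>"

text \<open>
  In \<open>Walk n i\<close> the stage is \<open>n\<close> and the level \<open>i\<close>; in \<open>Kill n j\<close> the walk has reached the barrier of stage \<open>n\<close>
  and has to survive \<open>j\<close> more trials.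
\<close>

datatype phase = Start | Head | Walk nat nat | Kill nat nat | Halt bool

definition barrier :: "nat \<Rightarrow> nat" where
  "barrier n = 2 * (n + 1)\<^sup>2"

primrec outcome :: "phase \<Rightarrow> bool option" where
  "outcome Start = None"
| "outcome Head = None"
| "outcome (Walk n i) = None"
| "outcome (Kill n j) = None"
| "outcome (Halt b) = Some b"

lemma outcome_eq_Some: "outcome s = Some b \<longleftrightarrow> s = Halt b"
  by (cases s) auto

primrec valid :: "phase \<Rightarrow> bool" where
  "valid Start \<longleftrightarrow> True"
| "valid Head \<longleftrightarrow> True"
| "valid (Walk n i) \<longleftrightarrow> 1 \<le> n \<and> 1 \<le> i \<and> i < barrier n"
| "valid (Kill n j) \<longleftrightarrow> 1 \<le> n \<and> 1 \<le> j \<and> j \<le> barrier n"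
| "valid (Halt b) \<longleftrightarrow> True"

primrec reads :: "phase \<Rightarrow> bool" where
  "reads Start \<longleftrightarrow> True"
| "reads Head \<longleftrightarrow> False"
| "reads (Walk n i) \<longleftrightarrow> True"
| "reads (Kill n j) \<longleftrightarrow> False"
| "reads (Halt b) \<longleftrightarrow> False"

primrec down :: "phase \<Rightarrow> bool \<Rightarrow> phase" where
  "down Start b = (if b then Head else Start)"
| "down Head b = Walk 1 1"
| "down (Walk n i) b = (if b then (if i = 1 then Halt True else Walk n (i - 1)) else Walk n i)"
| "down (Kill n j) b = (if j = 1 then Walk (n + 1) (barrier n) else Kill n (j - 1))"
| "down (Halt c) b = Halt c"

primrec up :: "phase \<Rightarrow> phase" where
  "up Start = Halt False"
| "up Head = Halt True"
| "up (Walk n i) = (if i + 1 = barrier n then Kill n (barrier n) else Walk n (i + 1))"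
| "up (Kill n j) = Halt False"
| "up (Halt c) = Halt c"

text \<open>
  The ratio of \<open>\<rho> n\<close> and \<open>\<rho> (n + 1)\<close>, or of \<open>n / (n + 1)\<close> and \<open>(n + 1) / (n + 2)\<close>: raising the
  walk from stage \<open>n\<close> to stage \<open>n + 1\<close> multiplies the debt per level by its inverse.
\<close>

definition survival :: "nat \<Rightarrow> real" where
  "survival n = real n * (real n + 2) / (real n + 1)\<^sup>2"

lemma survival_bounds: "1 \<le> n \<Longrightarrow> 0 < survival n" "survival n < 1"
  by (auto simp: survival_def power2_eq_square divide_simps algebra_simps add_pos_nonneg)

lemma barrier_mono: "barrier n < barrier (Suc n)"
  by (simp add: barrier_def power2_eq_square)

lemma barrier_1: "barrier (Suc 0) = 8"
  by (simp add: barrier_def power2_eq_square)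

lemma barrier_ge: "8 \<le> barrier n" if "1 \<le> n"
proof -
  have "2\<^sup>2 \<le> (n + 1)\<^sup>2" using that by (intro power_mono) auto
  then show ?thesis by (simp add: barrier_def)
qed

text \<open>
  The decision of probability \<open>f\<close>, with the uniform variable rescaled for further use.  In all programs
  below, register 0 holds the uniform variable, 1 and 2 hold \<open>C\<close> and \<open>M\<close>, 3 the kind of the phase (the
  values 4 and 5 stand for the outputs 0 and 1), and 4 and 5 its parameters; 6 and 7 are scratch
  registers for a threshold and a flip.
\<close>

abbreviation split_prog :: "rexp \<Rightarrow> prog \<Rightarrow> prog \<Rightarrow> prog" where
  "split_prog f P Q \<equiv> Seq (Assign 6 f) (IfLess (Reg 0) (Reg 6)
     (Seq (Assign 0 (Div (Reg 0) (Reg 6))) P)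
     (Seq (Assign 0 (Div (Sub (Reg 0) (Reg 6)) (Sub (Const 1) (Reg 6)))) Q))"

abbreviation inc :: "nat \<Rightarrow> rexp" where
  "inc k \<equiv> Add (Reg k) (Const 1)"

abbreviation dec :: "nat \<Rightarrow> rexp" where
  "dec k \<equiv> Sub (Reg k) (Const 1)"

abbreviation set_mode :: "rat \<Rightarrow> prog" where
  "set_mode m \<equiv> Assign 3 (Const m)"

abbreviation barrier_rexp :: rexp where
  "barrier_rexp \<equiv> Mul (Const 2) (Mul (inc 4) (inc 4))"

definition start_prog :: prog where
  "start_prog =
     split_prog (Div (Reg 1) (Add (Reg 1) (Sub (Const 1) (Mul (Const 2) (Reg 2)))))
       (Seq (Flip 7) (IfLess (Const 0) (Reg 7) (set_mode 1) Skip))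
       (set_mode 4)"

definition head_prog :: prog where
  "head_prog =
     split_prog (Mul (Const 2) (Reg 2))
       (Seq (set_mode 2) (Seq (Assign 4 (Const 1)) (Assign 5 (Const 1))))
       (set_mode 5)"

definition walk_prog :: prog where
  "walk_prog =
     split_prog (Div (Mul (Reg 4) (Reg 1)) (Add (Mul (Reg 4) (Reg 1)) (Mul (Reg 2) (inc 4))))
       (Seq (Flip 7) (IfLess (Const 0) (Reg 7)
         (IfLess (Const 1) (Reg 5) (Assign 5 (dec 5)) (set_mode 5))
         Skip))
       (Seq (Assign 5 (inc 5)) (IfLess (Reg 5) barrier_rexp Skip (set_mode 3)))"

definition kill_prog :: prog where
  "kill_prog =
     split_prog (Div (Mul (Reg 4) (Add (Reg 4) (Const 2))) (Mul (inc 4) (inc 4)))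
       (IfLess (Const 1) (Reg 5) (Assign 5 (dec 5))
         (Seq (set_mode 2) (Seq (Assign 5 barrier_rexp) (Assign 4 (inc 4)))))
       (set_mode 4)"

definition body_prog :: prog where
  "body_prog =
     IfLess (Reg 3) (Const 1) start_prog
       (IfLess (Reg 3) (Const 2) head_prog
         (IfLess (Reg 3) (Const 3) walk_prog kill_prog))"

definition loop_prog :: prog where
  "loop_prog = WhileLess (Reg 3) (Const 4) body_prog"

definition factory_prog :: prog where
  "factory_prog = Seq loop_prog (Assign 0 (Sub (Reg 3) (Const 4)))"

lemma loopfree_body: "loopfree body_prog"
  by (simp add: body_prog_def start_prog_def head_prog_def walk_prog_def kill_prog_def)

locale small_mean =
  fixes C M :: real
  assumes C: "0 < C" and M: "0 < M" "M < 1 / 2"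
begin

primrec prob :: "phase \<Rightarrow> real" where
  "prob Start = C / (C + (1 - 2 * M))"
| "prob Head = 2 * M"
| "prob (Walk n i) = real n * C / (real n * C + M * (real n + 1))"
| "prob (Kill n j) = survival n"
| "prob (Halt b) = 0"

sublocale coin_machine "Collect valid" outcome prob reads down up
proof
  fix s b
  assume "s \<in> Collect valid" "outcome s = None"
  then have s: "valid s" "outcome s = None" by auto
  show "0 < prob s \<and> prob s < 1"
    using s C M survival_bounds by (cases s) (auto simp: divide_simps add_pos_pos)
  show "down s b \<in> Collect valid"
    using s barrier_mono barrier_ge barrier_1 by (cases s) (auto simp: le_Suc_eq intro: order_trans[of 1 8])
  show "up s \<in> Collect valid"
    using s barrier_ge by (cases s) (auto intro: order_trans[of 1 8])
  show "down s False = down s True" if "\<not> reads s"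
    using s that by (cases s) auto
qed

definition encodes :: "phase \<Rightarrow> real \<Rightarrow> (nat \<Rightarrow> real) \<Rightarrow> bool" where
  "encodes s u r \<longleftrightarrow> r 0 = u \<and> r 1 = C \<and> r 2 = M \<and>
     (case s of Start \<Rightarrow> r 3 = 0 | Head \<Rightarrow> r 3 = 1
      | Walk n i \<Rightarrow> r 3 = 2 \<and> r 4 = n \<and> r 5 = i
      | Kill n j \<Rightarrow> r 3 = 3 \<and> r 4 = n \<and> r 5 = j
      | Halt b \<Rightarrow> r 3 = 4 + of_bool b)"

lemma encodes_running: "encodes s u r \<Longrightarrow> r 3 < 4 \<longleftrightarrow> outcome s = None"
  by (cases s) (auto simp: encodes_def)

lemma body_step:
  assumes s: "valid s" "outcome s = None" and r: "encodes s u r"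
  shows "\<exists>r'. effect x body_prog (r, n) = (r', n + of_bool (u < prob s \<and> reads s)) \<and>
    (if u < prob s then encodes (down s (x n)) (u / prob s) r'
     else encodes (up s) ((u - prob s) / (1 - prob s)) r')"
proof (cases s)
  case Start
  then show ?thesis using r
    by (simp add: encodes_def body_prog_def start_prog_def)
next
  case Head
  then show ?thesis using r
    by (simp add: encodes_def body_prog_def head_prog_def)
next
  case (Walk m i)
  have "real i + 1 < 2 * ((real m + 1) * (real m + 1)) \<longleftrightarrow> i + 1 \<noteq> barrier m"
  proof -
    have "2 * ((real m + 1) * (real m + 1)) = real (barrier m)"
      by (simp add: barrier_def power2_eq_square algebra_simps)
    moreover have "real i + 1 < real (barrier m) \<longleftrightarrow> i + 1 < barrier m" by linarith
    moreover have "i < barrier m" using s Walk by simp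
    ultimately show ?thesis by auto
  qed
  then show ?thesis using r s Walk
    by (auto simp: encodes_def body_prog_def walk_prog_def of_nat_diff)
next
  case (Kill m j)
  have "survival m = real m * (real m + 2) / ((real m + 1) * (real m + 1))"
    by (simp add: survival_def power2_eq_square)
  moreover have "real (barrier m) = 2 * ((real m + 1) * (real m + 1))"
    by (simp add: barrier_def power2_eq_square algebra_simps)
  ultimately show ?thesis using r s Kill
    by (auto simp: encodes_def body_prog_def kill_prog_def of_nat_diff)
next
  case (Halt b)
  then show ?thesis using s by simp
qed

lemma body_step_exec:
  assumes s: "valid s" "outcome s = None" and r: "encodes s u r" and e: "exec x body_prog (r, n) \<sigma>"
  obtains r' where "\<sigma> = (r', n + of_bool (u < prob s \<and> reads s))"
    "if u < prob s then encodes (down s (x n)) (u / prob s) r'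
     else encodes (up s) ((u - prob s) / (1 - prob s)) r'"
  using body_step[OF s r, of x n] exec_imp_effect[OF e loopfree_body] by auto

lemma rest_shift: "rest (\<lambda>i. x (n + i)) = (\<lambda>i. x (Suc n + i))"
  by (simp add: rest_def)

text \<open>
  The flips still unread after \<open>n\<close> of them are the sequence \<open>\<lambda>i. x (n + i)\<close>, and the loop and the chain
  consume it in lockstep.
\<close>

lemma loop_simulates_run:
  "valid s \<Longrightarrow> encodes s u r \<Longrightarrow> outcome (state k s u (\<lambda>i. x (n + i))) \<noteq> None \<Longrightarrow>
    \<exists>r' n' v. exec x loop_prog (r, n) (r', n') \<and> encodes (state k s u (\<lambda>i. x (n + i))) v r'"
proof (induction k arbitrary: s u r n)
  case 0
  then have "\<not> r 3 < 4" using encodes_running by auto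
  then have "exec x loop_prog (r, n) (r, n)"
    unfolding loop_prog_def by (intro exec.WhileFalse) simp
  with 0 show ?case by auto
next
  case (Suc k)
  show ?case
  proof (cases "outcome s")
    case (Some b)
    then have "\<not> r 3 < 4" using encodes_running Suc.prems by auto
    then have "exec x loop_prog (r, n) (r, n)"
      unfolding loop_prog_def by (intro exec.WhileFalse) simp
    with Suc.prems Some show ?thesis by auto
  next
    case None
    have run: "rval (Reg 3) (fst (r, n)) < rval (Const 4) (fst (r, n))"
      using encodes_running Suc.prems None by simp
    obtain r' where r': "exec x body_prog (r, n) (r', n + of_bool (u < prob s \<and> reads s))"
      "if u < prob s then encodes (down s (x n)) (u / prob s) r'
       else encodes (up s) ((u - prob s) / (1 - prob s)) r'"
      using body_step[OF Suc.prems(1) None Suc.prems(2), of x n] exec_effect[OF loopfree_body, of x "(r, n)"]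
      by metis
    define t where "t = (if u < prob s then down s (x n) else up s)"
    define w where "w = (if u < prob s then u / prob s else (u - prob s) / (1 - prob s))"
    define m where "m = n + of_bool (u < prob s \<and> reads s)"
    have st: "state (Suc k) s u (\<lambda>i. x (n + i)) = state k t w (\<lambda>i. x (m + i))"
      using None by (simp add: t_def w_def m_def rest_shift)
    have "valid t" using lo_good[of s "x n"] hi_good[of s] Suc.prems(1) None by (simp add: t_def)
    moreover have "encodes t w r'" using r'(2) by (simp add: t_def w_def split: if_splits)
    ultimately obtain r'' n'' v where
      "exec x loop_prog (r', m) (r'', n'')" "encodes (state k t w (\<lambda>i. x (m + i))) v r''"
      using Suc.IH[of t w r' m] Suc.prems(3) st by auto
    moreover have "exec x loop_prog (r, n) (r'', n'')"
      using exec.WhileTrue[OF run r'(1)[folded m_def]] calculation(1) unfolding loop_prog_def by blast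
    ultimately show ?thesis unfolding st by blast
  qed
qed

lemma run_simulates_loop:
  "exec x P \<sigma> \<sigma>' \<Longrightarrow> P = loop_prog \<Longrightarrow> \<sigma> = (r, n) \<Longrightarrow> valid s \<Longrightarrow> encodes s u r \<Longrightarrow>
    \<exists>k v. outcome (state k s u (\<lambda>i. x (n + i))) \<noteq> None \<and>
      encodes (state k s u (\<lambda>i. x (n + i))) v (fst \<sigma>')"
proof (induction arbitrary: s u r n rule: exec.induct)
  case (WhileFalse a \<sigma> b P)
  then have "outcome s \<noteq> None" using encodes_running by (auto simp: loop_prog_def)
  then show ?case using WhileFalse.prems by (intro exI[of _ 0] exI[of _ u]) auto
next
  case (WhileTrue a \<sigma> b P \<sigma>' \<sigma>'')
  then have None: "outcome s = None" using encodes_running by (auto simp: loop_prog_def)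
  have "exec x body_prog (r, n) \<sigma>'" using WhileTrue by (simp add: loop_prog_def)
  from body_step_exec[OF WhileTrue.prems(3) None WhileTrue.prems(4) this]
  obtain r' where r': "\<sigma>' = (r', n + of_bool (u < prob s \<and> reads s))"
    "if u < prob s then encodes (down s (x n)) (u / prob s) r'
     else encodes (up s) ((u - prob s) / (1 - prob s)) r'" by blast
  define t where "t = (if u < prob s then down s (x n) else up s)"
  define w where "w = (if u < prob s then u / prob s else (u - prob s) / (1 - prob s))"
  define m where "m = n + of_bool (u < prob s \<and> reads s)"
  have st: "state (Suc k) s u (\<lambda>i. x (n + i)) = state k t w (\<lambda>i. x (m + i))" for k
    using None by (simp add: t_def w_def m_def rest_shift)
  have "valid t" using lo_good[of s "x n"] hi_good[of s] WhileTrue.prems(3) None by (simp add: t_def)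
  moreover have "encodes t w r'" using r'(2) by (simp add: t_def w_def split: if_splits)
  ultimately obtain k v where "outcome (state k t w (\<lambda>i. x (m + i))) \<noteq> None"
    "encodes (state k t w (\<lambda>i. x (m + i))) v (fst \<sigma>'')"
    using WhileTrue.IH(2)[of r' m t w] WhileTrue.prems(1) r'(1) by (auto simp: m_def)
  then show ?case using st by (intro exI[of _ "Suc k"] exI[of _ v]) simp
qed (simp_all add: loop_prog_def)

lemma init_encodes: "encodes Start u (init_regs [C, M] u)"
  by (simp add: encodes_def init_regs_def)

lemma outputs_iff:
  "outputs [C, M] factory_prog u x y \<longleftrightarrow>
    (\<exists>k b. outcome (state k Start u x) = Some b \<and> y = of_bool b)"
proof
  assume "outputs [C, M] factory_prog u x y"
  then obtain r n where "exec x factory_prog (init_regs [C, M] u, 0) (r, n)" and y: "r 0 = y"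
    by (auto simp: outputs_def)
  then obtain \<sigma> where loop: "exec x loop_prog (init_regs [C, M] u, 0) \<sigma>"
    and last: "exec x (Assign 0 (Sub (Reg 3) (Const 4))) \<sigma> (r, n)"
    unfolding factory_prog_def by (metis exec_SeqE)
  from run_simulates_loop[OF loop refl refl _ init_encodes]
  obtain k v where k: "outcome (state k Start u x) \<noteq> None" "encodes (state k Start u x) v (fst \<sigma>)"
    by auto
  then obtain b where ob: "outcome (state k Start u x) = Some b" by blast
  then have b: "state k Start u x = Halt b" by (simp only: outcome_eq_Some)
  moreover have "r 0 = fst \<sigma> 3 - 4" using exec_imp_effect[OF last] by simp
  ultimately have "y = of_bool b" using k(2) y by (simp add: encodes_def)
  with ob show "\<exists>k b. outcome (state k Start u x) = Some b \<and> y = of_bool b" by blast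
next
  assume "\<exists>k b. outcome (state k Start u x) = Some b \<and> y = of_bool b"
  then obtain k b where k: "outcome (state k Start u x) = Some b" "y = of_bool b" by blast
  then have b: "state k Start u x = Halt b" by (simp only: outcome_eq_Some)
  from loop_simulates_run[OF _ init_encodes, of k u x 0] k b obtain r' n' v where
    loop: "exec x loop_prog (init_regs [C, M] u, 0) (r', n')" and e: "encodes (Halt b) v r'"
    by auto
  have "exec x factory_prog (init_regs [C, M] u, 0) (r'(0 := r' 3 - 4), n')"
    unfolding factory_prog_def using exec.Seq[OF loop exec.Assign[of x 0 "Sub (Reg 3) (Const 4)" r' n']]
    by simp
  moreover have "(r'(0 := r' 3 - 4)) 0 = y" using e k(2) by (simp add: encodes_def)
  ultimately show "outputs [C, M] factory_prog u x y" unfolding outputs_def by blast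
qed

end

section \<open>The target is harmonic and the cost is a potential\<close>

text \<open>
  With \<open>N = (n + 1)\<^sup>2\<close> this is \<open>(1 - 1 / N) ^ (2 * N) \<le> exp (- 2) \<le> (2 / 5)\<^sup>2\<close>.
\<close>

lemma survival_power_barrier: "survival n ^ barrier n \<le> 1 / 6"
proof -
  define N where "N = (n + 1)\<^sup>2"
  have N: "1 \<le> real N" by (simp add: N_def one_le_power)
  have "real n * (real n + 2) = (real n + 1)\<^sup>2 - 1" by (simp add: power2_eq_square algebra_simps)
  then have "survival n = 1 - 1 / (real n + 1)\<^sup>2" by (simp add: survival_def diff_divide_distrib)
  then have survival: "survival n = 1 - 1 / N" by (simp add: N_def add.commute)
  have "survival n ^ N \<le> exp (- 1 / N) ^ N"
    using exp_ge_add_one_self[of "- 1 / N"] N by (intro power_mono) (simp_all add: survival)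
  also have "\<dots> = exp (- 1)"
    using N by (simp flip: exp_of_nat_mult)
  also have "\<dots> \<le> 2 / 5"
    using exp_lower_Taylor_quadratic[of 1] by (simp add: exp_minus field_simps)
  finally have "(survival n ^ N)\<^sup>2 \<le> (2 / 5)\<^sup>2"
    by (intro power_mono) (simp_all add: survival_def)
  moreover have "survival n ^ barrier n = (survival n ^ N)\<^sup>2"
    by (simp add: barrier_def N_def mult.commute flip: power_mult)
  ultimately show ?thesis by (simp add: power2_eq_square)
qed

text \<open>
  The value is \<open>(3 / 4) ^ 8\<close>.  The first stage weighs most, and 1/6 would be too coarse for it.
\<close>

lemma survival_1_power_barrier: "survival 1 ^ barrier 1 \<le> 11 / 100"
proof -
  show ?thesis using barrier_1 by (simp add: survival_def power2_eq_square eval_nat_numeral)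
qed

locale small_mean_coin = small_mean +
  fixes p :: real
  assumes p: "0 \<le> p" "p \<le> 1" and Cp: "C * p \<le> M"
begin

definition \<rho> :: "nat \<Rightarrow> real" where
  "\<rho> n = real n * (C * p) / ((real n + 1) * M)"

lemma \<rho>_nonneg: "0 \<le> \<rho> n"
  using C M p by (simp add: \<rho>_def)

lemma \<rho>_le: "\<rho> n \<le> real n / (real n + 1)"
proof -
  have "\<rho> n = real n / (real n + 1) * (C * p / M)" by (simp add: \<rho>_def)
  also have "\<dots> \<le> real n / (real n + 1) * 1" using M Cp by (intro mult_left_mono) auto
  finally show ?thesis by (simp only: mult_1_right)
qed

lemma \<rho>_less_1: "\<rho> n < 1"
  using \<rho>_le[of n] by (rule le_less_trans) simp

lemma survival_\<rho>: "survival n * \<rho> (Suc n) = \<rho> n"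
  using M by (simp add: survival_def \<rho>_def divide_simps power2_eq_square) (simp add: algebra_simps)

primrec target :: "phase \<Rightarrow> real" where
  "target Start = C * p"
| "target Head = (1 - 2 * M) + C * p"
| "target (Walk n i) = \<rho> n ^ i"
| "target (Kill n j) = survival n ^ j * \<rho> (Suc n) ^ barrier n"
| "target (Halt b) = of_bool b"

text \<open>
  The walk seen in continuous time: up-steps at rate 1, flips at rate \<open>flip_rate n\<close>, and hence down-steps at
  rate \<open>flip_rate n * p = \<rho> n\<close>.
\<close>

definition flip_rate :: "nat \<Rightarrow> real" where
  "flip_rate n = real n * C / (M * (real n + 1))"

lemma flip_rate_nonneg: "0 \<le> flip_rate n"
  using C M by (simp add: flip_rate_def)

lemma flip_rate_p: "flip_rate n * p = \<rho> n"
  by (simp add: flip_rate_def \<rho>_def mult.commute mult.left_commute)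

lemma prob_Walk: "prob (Walk n i) = flip_rate n / (flip_rate n + 1)"
proof -
  define D where "D = M * (real n + 1)"
  have D: "D \<noteq> 0" using M by (simp add: D_def)
  then have "real n * C = flip_rate n * D" by (simp add: flip_rate_def D_def)
  then have "prob (Walk n i) = flip_rate n * D / ((flip_rate n + 1) * D)" by (simp add: D_def distrib_right)
  then show ?thesis using mult_divide_mult_cancel_right[OF D] by simp
qed

text \<open>
  Within a stage this is the harmonicity of powers of \<open>\<rho> n\<close> for the walk; at the barrier, the trials
  supply the factors \<open>survival n\<close> that complete \<open>\<rho> (Suc n)\<close> to \<open>\<rho> n\<close>.
\<close>

lemma harmonic_target: "harmonic p target"
  unfolding harmonic_def
proof (intro ballI conjI impI allI)
  fix s assume "s \<in> Collect valid"
  then have s: "valid s" by simp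
  have k: "0 \<le> survival n" "survival n \<le> 1" for n
    using survival_bounds(2)[of n] by (simp_all add: survival_def)
  note \<rho> = \<rho>_nonneg \<rho>_less_1[THEN less_imp_le]
  show "0 \<le> target s"
    using C M p k \<rho> by (cases s) auto
  show "target s \<le> 1"
    using C M p Cp k \<rho> by (cases s) (auto intro!: power_le_one mult_le_one)
  show "target s = of_bool b" if "outcome s = Some b" for b
    using that by (cases s) auto
  assume "outcome s = None"
  then show "target s = mean p target s"
  proof (cases s)
    case Start
    have "C + (1 - 2 * M) \<noteq> 0" using C M by simp
    then show ?thesis using Start by (simp add: mean_def divide_simps) (simp add: algebra_simps)
  next
    case Head
    have "2 * M * \<rho> 1 = C * p" using M by (simp add: \<rho>_def)
    then show ?thesis using Head by (simp add: mean_def algebra_simps)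
  next
    case (Walk n i)
    then obtain l where i: "i = Suc l" using s by (cases i) auto
    have down: "target (down (Walk n i) True) = \<rho> n ^ l" by (simp add: i)
    have up: "target (up (Walk n i)) = \<rho> n ^ Suc i"
    proof (cases "i + 1 = barrier n")
      case True
      have "survival n ^ barrier n * \<rho> (Suc n) ^ barrier n = \<rho> n ^ barrier n"
        by (simp add: survival_\<rho> flip: power_mult_distrib)
      then show ?thesis using True by simp
    qed simp
    have "flip_rate n + 1 \<noteq> 0" using flip_rate_nonneg[of n] by simp
    then have "prob s * (p * \<rho> n ^ l + (1 - p) * \<rho> n ^ i) + (1 - prob s) * \<rho> n ^ Suc i =
        (flip_rate n * p * \<rho> n ^ l + flip_rate n * \<rho> n ^ i - flip_rate n * p * \<rho> n ^ i + \<rho> n ^ Suc i) / (flip_rate n + 1)"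
      unfolding Walk prob_Walk by (simp add: divide_simps) (simp add: algebra_simps)
    also have "\<dots> = \<rho> n ^ i"
      using \<open>flip_rate n + 1 \<noteq> 0\<close> unfolding flip_rate_p by (simp add: i divide_simps) (simp add: algebra_simps)
    finally show ?thesis using Walk down up by (simp add: mean_def)
  next
    case (Kill n j)
    then obtain l where j: "j = Suc l" using s by (cases j) auto
    have "target (down s b) = survival n ^ l * \<rho> (Suc n) ^ barrier n" for b
      using Kill j by simp
    then show ?thesis using Kill by (simp add: mean_def j algebra_simps)
  qed simp
qed

text \<open>
  In the unit \<open>C / (2 * M)\<close>, the flip rate of stage 1, \<open>\<eta>\<close> is 1/100 and \<open>\<kappa>\<close> is 101/100.  Since up-steps have
  rate 1 and are charged \<open>\<eta>\<close>, \<open>\<kappa>\<close> is the total charge per unit of time in stage 1.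
\<close>

definition \<eta> :: real where
  "\<eta> = C / (200 * M)"

definition \<kappa> :: real where
  "\<kappa> = 101 * C / (200 * M)"

text \<open>
  In units of \<open>\<kappa>\<close>, a bound on the cost from the beginning of stage
  \<open>n \<ge> 2\<close> on.  The stage has \<open>4 * n + 2\<close> new levels of cost \<open>2 * n\<close> each and is survived with probability
  at most 1/6, so that a bound \<open>X\<close> has to satisfy \<open>8 * n\<^sup>2 + 4 * n + X (n + 1) / 6 \<le> X n\<close>.  The quadratic
  polynomial chosen here does, with some room for the charges \<open>\<eta>\<close> of the trials.
\<close>

definition stage_cost :: "nat \<Rightarrow> real" where
  "stage_cost n = 10 * (real n)\<^sup>2 + 9 * real n + 4"

text \<open>
  The cost on arrival at the barrier, that is, of \<open>Kill n (barrier n)\<close>.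
\<close>

definition top_cost :: "nat \<Rightarrow> real" where
  "top_cost n = \<kappa> * stage_cost (n + 1) * survival n ^ barrier n + \<eta> * (real n * (real n + 2))"

text \<open>
  The cost of stage 1 from level \<open>i\<close>, in units of \<open>\<kappa>\<close>.  Solving the equation
  \<open>1 + \<rho> 1 * (g (i - 1) - g i) + (g (i + 1) - g i) = 0\<close> upwards from \<open>g 0 = 0\<close> and \<open>g 1 = 14\<close> gives this recursion.  The bound
  linear in \<open>i\<close> that is used in later stages ignores that the walk may leave at 0, which would be too
  expensive here.  The value 14 is 7 for climbing from 1 to the barrier 8, plus 7 for what comes after it.
\<close>

primrec first_cost :: "nat \<Rightarrow> real" where
  "first_cost 0 = 0"
| "first_cost (Suc i) = 14 - real i + \<rho> 1 * first_cost i"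

text \<open>
  \<open>cost Start\<close> and \<open>cost Head\<close> solve their equations exactly, \<open>14 * \<kappa>\<close> being the cost of \<open>Walk 1 1\<close>.  In later
  stages the cost is linear in the level, with slope \<open>- 2 * n * \<kappa>\<close>.  The term \<open>\<eta> * (n * (n + 2))\<close> pays for the
  trials: with success probability \<open>q = survival n\<close>, the mean number of successes before a failure is
  \<open>q / (1 - q) = n * (n + 2)\<close>.
\<close>

primrec cost :: "phase \<Rightarrow> real" where
  "cost Start = (C + C * p * (2 * M * (\<eta> + 14 * \<kappa>))) / (1 - 2 * M + C * p)"
| "cost Head = 2 * M * (\<eta> + 14 * \<kappa>)"
| "cost (Walk n i) = (if n = 1 then \<kappa> * first_cost i
     else top_cost n + 2 * n * \<kappa> * (real (barrier n) - i))"
| "cost (Kill n j) = \<kappa> * stage_cost (n + 1) * survival n ^ j + \<eta> * (real n * (real n + 2))"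
| "cost (Halt b) = 0"

lemma \<eta>_pos: "0 < \<eta>" and \<kappa>_pos: "0 < \<kappa>" and \<kappa>_\<eta>: "\<kappa> = 101 * \<eta>"
  using C M by (simp_all add: \<eta>_def \<kappa>_def)

lemma flip_rate_\<eta>: "flip_rate n = real n * 200 * \<eta> / (real n + 1)"
  using M by (simp add: flip_rate_def \<eta>_def divide_simps)

lemma stage_cost_nonneg: "0 \<le> stage_cost n"
  by (simp add: stage_cost_def)

lemma survival_nonneg: "0 \<le> survival n"
  by (simp add: survival_def)

lemma top_cost_nonneg: "0 \<le> top_cost n"
  using \<eta>_pos \<kappa>_pos by (simp add: top_cost_def stage_cost_nonneg survival_nonneg)

lemma first_cost_nonneg: "i \<le> 8 \<Longrightarrow> 0 \<le> first_cost i"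
proof (induction i)
  case (Suc i)
  then show ?case using \<rho>_nonneg[of 1] by (simp add: add_nonneg_nonneg)
qed simp

text \<open>
  Dropping the nonnegative multiple of \<open>\<rho> 1\<close> leaves \<open>first_cost 8 \<ge> 14 - 7\<close>, and \<open>62 * 11 / 100\<close> plus the
  cost of the trials is below 7.
\<close>

lemma top_cost_1: "top_cost 1 \<le> \<kappa> * first_cost 8"
proof -
  have "7 \<le> first_cost 8"
  proof -
    have "first_cost (Suc 7) = 7 + \<rho> 1 * first_cost 7" by (subst first_cost.simps(2)) simp
    moreover have "0 \<le> \<rho> 1 * first_cost 7"
      using \<rho>_nonneg[of 1] first_cost_nonneg[of 7] by simp
    ultimately show ?thesis by (simp del: first_cost.simps)
  qed
  moreover have "top_cost 1 \<le> \<kappa> * 7"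
  proof -
    have "stage_cost (1 + 1) = 62" by (simp add: stage_cost_def)
    then have "\<kappa> * stage_cost (1 + 1) * survival 1 ^ barrier 1 \<le> \<kappa> * 62 * (11 / 100)"
      using survival_1_power_barrier \<kappa>_pos by (simp del: One_nat_def)
    moreover have "\<eta> * (real 1 * (real 1 + 2)) = 3 / 101 * \<kappa>" by (simp add: \<kappa>_\<eta>)
    ultimately show ?thesis using \<kappa>_pos unfolding top_cost_def by linarith
  qed
  ultimately show ?thesis using \<kappa>_pos by (meson mult_left_mono less_imp_le order_trans)
qed

text \<open>
  The inequality for which the coefficients of \<open>stage_cost\<close> are chosen.
\<close>

lemma stage_start_cost:
  "cost (Walk (Suc n) (barrier n)) \<le> \<kappa> * stage_cost (Suc n)" if "1 \<le> n"
proof -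
  define m where "m = real (Suc n)"
  have m: "1 \<le> m" by (simp add: m_def)
  have "\<kappa> * stage_cost (Suc n + 1) * survival (Suc n) ^ barrier (Suc n) \<le>
      \<kappa> * stage_cost (Suc n + 1) * (1 / 6)"
    using survival_power_barrier[of "Suc n"] \<kappa>_pos stage_cost_nonneg by (intro mult_left_mono) auto
  moreover have "stage_cost (Suc n + 1) = 10 * (m + 1)\<^sup>2 + 9 * (m + 1) + 4"
    "stage_cost (Suc n) = 10 * m\<^sup>2 + 9 * m + 4" by (simp_all add: stage_cost_def m_def)
  moreover have "real (barrier (Suc n)) - barrier n = 4 * m + 2"
    by (simp add: barrier_def m_def power2_eq_square algebra_simps)
  moreover have "cost (Walk (Suc n) (barrier n)) =
      \<kappa> * stage_cost (Suc n + 1) * survival (Suc n) ^ barrier (Suc n) + \<kappa> / 101 * (m * (m + 2)) +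
      2 * m * \<kappa> * (real (barrier (Suc n)) - barrier n)"
    using that by (simp add: top_cost_def \<kappa>_\<eta> m_def)
  ultimately have "cost (Walk (Suc n) (barrier n)) \<le>
      \<kappa> * (10 * (m + 1)\<^sup>2 + 9 * (m + 1) + 4) * (1 / 6) + \<kappa> / 101 * (m * (m + 2)) + 2 * m * \<kappa> * (4 * m + 2)"
    by simp
  also have "\<dots> = \<kappa> * ((10 * (m + 1)\<^sup>2 + 9 * (m + 1) + 4) / 6 + m * (m + 2) / 101 + 2 * m * (4 * m + 2))"
    by (simp add: field_simps)
  also have "\<dots> \<le> \<kappa> * (10 * m\<^sup>2 + 9 * m + 4)"
  proof (rule mult_left_mono)
    have "0 \<le> m * m" by simp
    then show "(10 * (m + 1)\<^sup>2 + 9 * (m + 1) + 4) / 6 + m * (m + 2) / 101 + 2 * m * (4 * m + 2) \<le>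
        10 * m\<^sup>2 + 9 * m + 4"
      using m by (simp add: power2_eq_square field_simps)
  qed (use \<kappa>_pos in simp)
  finally show ?thesis by (simp add: stage_cost_def m_def)
qed

text \<open>
  The supersolution inequality for a phase of the walk, with neighbours of cost \<open>a\<close> below and \<open>c\<close> above, rewritten from
  the jump chain to continuous time.
\<close>

lemma walk_drift:
  assumes "flip_rate n + \<eta> + \<rho> n * (a - b) + (c - b) \<le> 0"
  shows "flip_rate n / (flip_rate n + 1) * 1 + (1 - flip_rate n / (flip_rate n + 1)) * \<eta> +
    (flip_rate n / (flip_rate n + 1) * (p * a + (1 - p) * b) + (1 - flip_rate n / (flip_rate n + 1)) * c) \<le> b"
proof -
  have K: "0 < flip_rate n + 1" using flip_rate_nonneg[of n] by simp
  have "flip_rate n / (flip_rate n + 1) * 1 + (1 - flip_rate n / (flip_rate n + 1)) * \<eta> +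
    (flip_rate n / (flip_rate n + 1) * (p * a + (1 - p) * b) + (1 - flip_rate n / (flip_rate n + 1)) * c) - b =
    (flip_rate n + \<eta> + flip_rate n * p * (a - b) + (c - b)) / (flip_rate n + 1)"
    using K by (simp add: divide_simps) (simp add: algebra_simps)
  also have "\<dots> \<le> 0" unfolding flip_rate_p using assms K by (intro divide_nonpos_pos) auto
  finally show ?thesis by simp
qed

text \<open>
  In stage 1 the inequality is the equation that defines \<open>first_cost\<close>.  In later stages the drift is at
  least \<open>1 / (n + 1)\<close>, so that the slope \<open>2 * n * \<kappa>\<close> earns at least \<open>2 * n * \<kappa> / (n + 1)\<close> per unit of time,
  which covers the charge \<open>flip_rate n + \<eta>\<close>.
\<close>

lemma potential_cost: "potential p \<eta> cost"
  unfolding potential_def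
proof (intro ballI conjI impI)
  fix s assume "s \<in> Collect valid"
  then have s: "valid s" by simp
  show "0 \<le> cost s"
  proof (cases s)
    case (Walk n i)
    have "i \<le> 8" if "n = 1" using s Walk that barrier_1 by simp
    moreover have "0 \<le> 2 * real n * \<kappa> * (real (barrier n) - i)"
      using s Walk \<kappa>_pos by simp
    ultimately show ?thesis using Walk first_cost_nonneg \<kappa>_pos top_cost_nonneg[of n] by simp
  qed (use C M p \<eta>_pos \<kappa>_pos stage_cost_nonneg survival_nonneg in auto)
  assume "outcome s = None"
  then show "prob s * (if reads s then 1 else \<eta>) +
      (1 - prob s) * (if outcome (up s) = None then \<eta> else 0) + mean p cost s \<le> cost s"
  proof (cases s)
    case Start
    let ?D = "1 - 2 * M + C * p"
    have D: "0 < ?D" using M C p by (simp add: add_pos_nonneg)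
    have CD: "0 < C + (1 - 2 * M)" using C M by simp
    have "cost Start * ?D = C + C * p * cost Head" using D by simp
    then have "C + C * p * cost Head + C * (1 - p) * cost Start = cost Start * (C + (1 - 2 * M))"
      by (simp only: algebra_simps)
    then have "C / (C + (1 - 2 * M)) * (1 + (p * cost Head + (1 - p) * cost Start)) = cost Start"
      using CD by (simp add: field_simps del: cost.simps)
    then show ?thesis unfolding Start by (simp add: mean_def algebra_simps del: cost.simps(1,2))
  next
    case Head
    have "first_cost 1 = 14" by simp
    then show ?thesis using Head by (simp add: mean_def algebra_simps)
  next
    case (Walk n i)
    then have n: "1 \<le> n" and i: "1 \<le> i" "i < barrier n" using s by auto
    define a b c where "a = cost (down s True)" and "b = cost s" and "c = cost (up s)"
    have "flip_rate n + \<eta> + \<rho> n * (a - b) + (c - b) \<le> 0"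
    proof (cases "n = 1")
      case True
      obtain l where l: "i = Suc l" using i by (cases i) auto
      have b: "b = \<kappa> * first_cost (Suc l)" and a: "a = \<kappa> * first_cost l"
        using Walk True l by (auto simp: a_def b_def)
      have c: "c \<le> \<kappa> * first_cost (Suc (Suc l))"
      proof (cases "i + 1 = barrier n")
        case top: True
        then have "c = top_cost 1" using Walk True by (simp add: c_def top_cost_def)
        moreover have "Suc (Suc l) = 8" using top True l barrier_1 by simp
        ultimately show ?thesis using top_cost_1 by (simp only:)
      qed (use Walk True l in \<open>auto simp: c_def\<close>)
      have "flip_rate n = 100 * \<eta>" using True by (simp add: flip_rate_\<eta>)
      moreover have "first_cost (Suc (Suc l)) - first_cost (Suc l) =
          \<rho> 1 * (first_cost (Suc l) - first_cost l) - 1"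
        by (simp add: algebra_simps)
      then have "\<kappa> * (first_cost (Suc (Suc l)) - first_cost (Suc l)) =
          \<kappa> * (\<rho> 1 * (first_cost (Suc l) - first_cost l) - 1)" by simp
      ultimately show ?thesis using c unfolding a b True by (simp add: algebra_simps \<kappa>_\<eta>)
    next
      case False
      define T where "T = top_cost n + 2 * n * \<kappa> * (real (barrier n) - i)"
      have b: "b = T" using Walk False by (simp add: b_def T_def)
      have T0: "0 \<le> T" using top_cost_nonneg[of n] i \<kappa>_pos by (simp add: T_def)
      \<comment> \<open>At level 1 the walk steps down into the output 1, of cost 0, below the linear bound.\<close>
      have a: "a - b \<le> 2 * n * \<kappa>"
      proof (cases "i = 1")
        case True
        then have "a = 0" using Walk by (simp add: a_def)
        moreover have "0 \<le> 2 * real n * \<kappa>" using \<kappa>_pos by simp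
        ultimately show ?thesis using T0 b by linarith
      next
        case i1: False
        then show ?thesis using Walk False i by (simp add: a_def b T_def of_nat_diff algebra_simps)
      qed
      have c: "c - b = - (2 * n * \<kappa>)"
      proof (cases "i + 1 = barrier n")
        case True
        then have "real (barrier n) - i = 1" by linarith
        with True show ?thesis using Walk False by (simp add: c_def b T_def top_cost_def)
      qed (use Walk False in \<open>simp add: c_def b T_def algebra_simps\<close>)
      have "\<rho> n * (a - b) \<le> real n / (real n + 1) * (2 * n * \<kappa>)"
      proof -
        have "\<rho> n * (a - b) \<le> \<rho> n * (2 * n * \<kappa>)" using a \<rho>_nonneg by (intro mult_left_mono) auto
        also have "\<dots> \<le> real n / (real n + 1) * (2 * n * \<kappa>)"
          using \<rho>_le \<kappa>_pos by (intro mult_right_mono) auto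
        finally show ?thesis .
      qed
      moreover have "flip_rate n + \<eta> + real n / (real n + 1) * (2 * n * \<kappa>) - 2 * n * \<kappa> \<le> 0"
      proof -
        have "flip_rate n + \<eta> + real n / (real n + 1) * (2 * n * \<kappa>) - 2 * n * \<kappa> = (1 - real n) * \<eta> / (n + 1)"
          by (simp add: flip_rate_\<eta> \<kappa>_\<eta> divide_simps) (simp add: algebra_simps)
        also have "\<dots> \<le> 0" using n \<eta>_pos by (intro divide_nonpos_pos mult_nonpos_nonneg) auto
        finally show ?thesis .
      qed
      ultimately show ?thesis using c by linarith
    qed
    from walk_drift[OF this] show ?thesis
      unfolding mean_def a_def b_def c_def using Walk prob_Walk[of n i] by (simp del: prob.simps cost.simps)
  next
    case (Kill n j)
    then have n: "1 \<le> n" and j: "1 \<le> j" using s by auto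
    define h where "h = real n * (real n + 2)"
    define X where "X = \<kappa> * stage_cost (Suc n)"
    obtain l where l: "j = Suc l" using j by (cases j) auto
    have h: "0 \<le> h" by (simp add: h_def)
    have "(real n + 1)\<^sup>2 = 1 + h" by (simp add: h_def power2_eq_square algebra_simps)
    then have "survival n = h / (1 + h)" by (simp add: survival_def h_def)
    then have k: "survival n * (1 + h) = h" "0 \<le> survival n" using h by simp_all
    have "cost (down s b) \<le> X * survival n ^ l + \<eta> * h" for b
    proof (cases "l = 0")
      case True
      then have "cost (down s b) \<le> X"
        using Kill l stage_start_cost[OF n] by (simp add: X_def del: cost.simps)
      moreover have "0 \<le> \<eta> * h" using \<eta>_pos h by simp
      ultimately show ?thesis using True by simp
    next
      case False
      then show ?thesis using Kill l by (simp add: X_def h_def)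
    qed
    then have "survival n * (\<eta> + (p * cost (down s True) + (1 - p) * cost (down s False))) \<le>
        survival n * (\<eta> + (p * (X * survival n ^ l + \<eta> * h) + (1 - p) * (X * survival n ^ l + \<eta> * h)))"
      using p k(2) by (intro mult_left_mono add_left_mono add_mono) auto
    also have "\<dots> = X * survival n ^ j + \<eta> * (survival n * (1 + h))"
      by (simp add: l algebra_simps)
    also have "\<dots> = cost s" using Kill by (simp only: k(1)) (simp add: X_def h_def)
    finally show ?thesis using Kill by (simp add: mean_def distrib_left del: cost.simps(4) down.simps)
  qed simp
qed

text \<open>
  The first term uses \<open>(1 - 2 * M) * (1 + C * p) \<le> 1 - 2 * M + C * p\<close>; in the second one the constant is
  \<open>14.15\<close>, namely \<open>14 * 1.01\<close> for \<open>Walk 1 1\<close> and \<open>0.01\<close> for the step into it.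
\<close>

lemma cost_Start_le:
  "cost Start \<le> C / ((1 - 2 * M) * (1 + C * p)) + C * p * (C * (15.2 / (1 - 2 * M + C * p)))"
proof -
  define d r where "d = 1 - 2 * M" and "r = C * p"
  have d: "0 < d" "d \<le> 1" and r: "0 \<le> r" using C M p by (simp_all add: d_def r_def)
  have "2 * M * (\<eta> + 14 * \<kappa>) = 14.15 * C" using M by (simp add: \<eta>_def \<kappa>_def field_simps)
  then have "cost Start = (C + r * (14.15 * C)) / (d + r)"
    by (simp only: cost.simps d_def r_def)
  then have "cost Start = C / (d + r) + r * (C * (14.15 / (d + r)))"
    by (simp add: add_divide_distrib mult_ac)
  also have "\<dots> \<le> C / (d * (1 + r)) + r * (C * (15.2 / (d + r)))"
  proof (intro add_mono mult_left_mono divide_right_mono divide_left_mono)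
    have "d * r \<le> 1 * r" using d r by (intro mult_right_mono) auto
    then show "d * (1 + r) \<le> d + r" by (simp add: algebra_simps)
  qed (use d r C in auto)
  finally show ?thesis by (simp add: d_def r_def)
qed

end

context small_mean
begin

lemma bernoulli_factory_accepts:
  "bernoulli_factory [C, M] (\<lambda>p. C * p) {p \<in> {0..1}. C * p \<le> M} (accepts Start)"
  unfolding bernoulli_factory_def
proof (intro conjI ballI)
  let ?D = "{p \<in> {0..1}. C * p \<le> M}"
  have start: "Start \<in> Collect valid" by simp
  show "?D \<subseteq> {0..1}" by auto
  show "(\<lambda>p. C * p) ` ?D \<subseteq> {0..1}" using C M by auto
  show "computable_on [C, M] ?D (accepts Start)"
    unfolding computable_on_def
  proof (intro exI[of _ factory_prog] conjI ballI allI impI)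
    fix u x y assume "outputs [C, M] factory_prog u x y"
    then obtain k b where k: "outcome (state k Start u x) = Some b" "y = of_bool b"
      unfolding outputs_iff by blast
    then show "y = of_bool (accepts Start u x)" using accepts_iff[of k Start u x] by simp
  next
    fix p assume "p \<in> ?D"
    then interpret small_mean_coin C M p by unfold_locales auto
    show "AE (u, x) in factory_space p. \<exists>y. outputs [C, M] factory_prog u x y"
      using AE_halts[OF p \<eta>_pos harmonic_target potential_cost start]
    proof eventually_elim
      case (elim \<omega>)
      then show ?case unfolding outputs_iff split_beta' by blast
    qed
  qed
  fix p assume "p \<in> ?D"
  then interpret small_mean_coin C M p by unfold_locales auto
  note facts = p \<eta>_pos harmonic_target potential_cost start
  show "stopping_time natural_filtration (running_time (accepts Start))"
    by (rule stopping_time_accepts[OF start])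
  show "AE \<omega> in factory_space p. running_time (accepts Start) \<omega> < \<infinity>"
    by (rule AE_running_time_finite[OF facts])
  show "(\<lambda>(u, x). accepts Start u x) \<in> factory_space p \<rightarrow>\<^sub>M count_space UNIV"
    using pred_accepts[OF facts] by (simp add: split_beta')
  show "distr (factory_space p) (count_space UNIV) (\<lambda>(u, x). accepts Start u x) =
      measure_pmf (bernoulli_pmf (C * p))"
    using distr_accepts[OF facts] by simp
qed

end

lemma running_time_const: "running_time (\<lambda>_ _. b) \<omega> = 0"
proof -
  have "running_time (\<lambda>_ _. b) (fst \<omega>, snd \<omega>) \<le> enat 0" unfolding running_time_le_iff by simp
  then show ?thesis by (simp add: zero_enat_def[symmetric])
qed

lemma bernoulli_factory_never:
  assumes "0 < C" "M \<le> 0"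
  shows "bernoulli_factory [C, M] (\<lambda>p. C * p) {p \<in> {0..1}. C * p \<le> M} (\<lambda>_ _. False)"
  unfolding bernoulli_factory_def
proof (intro conjI ballI)
  let ?D = "{p \<in> {0..1}. C * p \<le> M}"
  have D: "p = 0" if "p \<in> ?D" for p
  proof -
    have "C * p \<le> 0" "0 \<le> p" using that assms by auto
    then show ?thesis using assms by (simp add: mult_le_0_iff)
  qed
  show "?D \<subseteq> {0..1}" by auto
  show "(\<lambda>p. C * p) ` ?D \<subseteq> {0..1}"
  proof (rule image_subsetI)
    fix p assume "p \<in> ?D"
    then have "p = 0" by (rule D)
    then show "C * p \<in> {0..1}" by simp
  qed
  show "computable_on [C, M] ?D (\<lambda>_ _. False)"
    unfolding computable_on_def
  proof (intro exI[of _ "Assign 0 (Const 0)"] conjI ballI allI impI)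
    fix u x y assume "outputs [C, M] (Assign 0 (Const 0)) u x y"
    then obtain r n where "exec x (Assign 0 (Const 0)) (init_regs [C, M] u, 0) (r, n)" "r 0 = y"
      by (auto simp: outputs_def)
    with exec_imp_effect[OF this(1)] show "y = of_bool False" by simp
  next
    fix p
    have "outputs [C, M] (Assign 0 (Const 0)) u x 0" for u x
      unfolding outputs_def
      by (rule exI[of _ "(init_regs [C, M] u)(0 := 0)"], rule exI[of _ 0])
        (use exec.Assign[of x 0 "Const 0" "init_regs [C, M] u" 0] in simp)
    then show "AE (u, x) in factory_space p. \<exists>y. outputs [C, M] (Assign 0 (Const 0)) u x y"
      unfolding split_beta' by (intro AE_I2 exI)
  qed
  fix p assume "p \<in> ?D"
  then have [simp]: "p = 0" by (rule D)
  interpret prob_space "factory_space p" by (rule prob_space_factory_space)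
  show "stopping_time natural_filtration (running_time (\<lambda>_ _. False))"
    unfolding running_time_const by (rule stopping_time_const)
  show "AE \<omega> in factory_space p. running_time (\<lambda>_ _. False) \<omega> < \<infinity>"
    by (simp add: running_time_const)
  show meas: "(\<lambda>(u, x). False) \<in> factory_space p \<rightarrow>\<^sub>M count_space UNIV" by simp
  have "emeasure (distr (factory_space p) (count_space UNIV) (\<lambda>(u, x). False)) {b} =
      emeasure (measure_pmf (bernoulli_pmf 0)) {b}" for b
    using emeasure_space_1 emeasure_distr[OF meas, of "{b}"]
    by (cases b) (simp_all add: emeasure_pmf_single vimage_def split_beta')
  then show "distr (factory_space p) (count_space UNIV) (\<lambda>(u, x). False) =
      measure_pmf (bernoulli_pmf (C * p))"
    by (intro measure_eqI_countable[of _ UNIV]) auto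
qed

theorem theorem1:
  fixes C M :: real
  assumes "C > 0" and "M < 1 / 2"
  shows "\<exists>A. bernoulli_factory [C, M] (\<lambda>p. C * p) {p \<in> {0..1}. C * p \<le> M} A \<and>
    (\<forall>p\<in>{0..1}. C * p \<le> M \<longrightarrow>
      (\<integral>\<^sup>+\<omega>. ennreal_of_enat (running_time A \<omega>) \<partial>factory_space p)
        \<le> ennreal (C / ((1 - 2 * M) * (1 + C * p)) + C * p * (C * (15.2 / (1 - 2 * M + C * p)))))"
proof (cases "0 < M")
  case True
  interpret small_mean C M using assms True by unfold_locales
  show ?thesis
  proof (intro exI[of _ "accepts Start"] conjI ballI impI bernoulli_factory_accepts)
    fix p :: real assume "p \<in> {0..1}" "C * p \<le> M"
    then interpret small_mean_coin C M p by unfold_locales auto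
    have start: "Start \<in> Collect valid" by simp
    show "(\<integral>\<^sup>+\<omega>. ennreal_of_enat (running_time (accepts Start) \<omega>) \<partial>factory_space p)
        \<le> ennreal (C / ((1 - 2 * M) * (1 + C * p)) + C * p * (C * (15.2 / (1 - 2 * M + C * p))))"
      using nn_integral_running_time[OF p \<eta>_pos harmonic_target potential_cost start]
        ennreal_leI[OF cost_Start_le] by (rule order_trans)
  qed
next
  case False
  then show ?thesis using bernoulli_factory_never[of C M] assms
    by (intro exI[of _ "\<lambda>_ _. False"]) (simp add: running_time_const)
qed

end
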